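(* Consider the discrete-time LPV system $x_{k+1}=A(p_k)x_k+B(p_k)u_k$ with affine $A(p)=A_0+\sum_{i=1}^{n_p}p_iA_i$, $B(p)=B_0+\sum_{i=1}^{n_p}p_iB_i$, and a data set $\mathcal{D}$ from it such that $\mathcal{D}_p$ has full row rank $(1+n_p)(n_x+n_u)$. Let $K(p)=K_0+\sum_i p_iK_i$ be a given LPV state-feedback controller, $\bar K=[K_1\ \cdots\ K_{n_p}]$, and $$\mathcal{M}_{CL}=\begin{bmatrix} I_{n_x}&0&0\\ 0& I_{n_p}\otimes I_{n_x}&0\\ K_0&\bar K&0\\ 0& I_{n_p}\otimes K_0& I_{n_p}\otimes \bar K\end{bmatrix}.$$ Suppose there exist $P\in\mathbb{S}^{n_x}$ with $P\succ0$, matrices $\mathcal{F}\in\mathbb{R}^{(N_d-1)\times n_x(1+n_p+n_p^2)}$ and $F_Q\in\mathbb{R}^{(N_d-1)(1+n_p)\times n_x(1+n_p)}$ related by $$\mathcal{F}\begin{bmatrix}I_{n_x}\\ p\otimes I_{n_x}\\ p\otimes p\otimes I_{n_x}\end{bmatrix}=\begin{bmatrix}I_{N_d-1}\\ p\otimes I_{N_d-1}\end{bmatrix}^\top F_Q\begin{bmatrix}I_{n_x}\\ p\otimes I_{n_x}\end{bmatrix}\quad\forall p\in\mathbb{P},$$ and a multiplier $\Xi\in\mathbb{S}^{4n_pn_x}$ such that $$\mathcal{M}_{CL}\,\mathrm{blkdiag}(P,\ I_{n_p}\otimes P,\ I_{n_p}\otimes I_{n_p}\otimes P)=\mathcal{D}_p\mathcal{F},$$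 and the full-block LMI conditions (defined in the context) hold with $\Delta(p)=\mathrm{diag}(p)\otimes I_{2n_x}$, $W=\begin{bmatrix}P_0&\mathcal{X}_+F_Q\\ (\mathcal{X}_+F_Q)^\top & P_0\end{bmatrix}$, $P_0=\mathrm{blkdiag}(P,0_{n_xn_p})$, $\mathcal{X}_+=\mathrm{blkdiag}(X_+,I_{n_p}\otimes X_+)$, and $L_{11}=0_{2n_xn_p}$, $L_{12}=1_{n_p}\otimes I_{2n_x}$, $L_{21}=\begin{bmatrix}0_{n_x\times 2n_xn_p}\\ I_{n_p}\otimes[I_{n_x}\ 0]\\ 0_{n_x\times 2n_xn_p}\\ I_{n_p}\otimes[0\ I_{n_x}]\end{bmatrix}$, $L_{22}=\begin{bmatrix}[I_{n_x}\ 0]\\ 1_{n_p}\otimes 0_{n_x\times 2n_x}\\ [0\ I_{n_x}]\\ 1_{n_p}\otimes 0_{n_x\times 2n_x}\end{bmatrix}$. Then $K(p)$ stabilizes the system under the feedback law $u_k=K(p_k)x_k$.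
   Context: Notation: $\otimes$ Kronecker product; $I_n$ identity; $0_{n\times m}$, $0_n$ zero matrices; $1_n\in\mathbb{R}^n$ the all-ones vector; $\mathbb{S}^n$ real symmetric $n\times n$ matrices; $\mathrm{blkdiag}$ block-diagonal concatenation; $\mathrm{diag}(p)$ diagonal matrix with the entries of $p$. The system has fully measured state $x_k\in\mathbb{R}^{n_x}$, input $u_k\in\mathbb{R}^{n_u}$, scheduling $p_k\in\mathbb{P}\subset\mathbb{R}^{n_p}$ with $\mathbb{P}$ compact and convex; $A_i,B_i$ unknown real matrices. $\mathcal{D}=\{u^d_k,p^d_k,x^d_k\}_{k=1}^{N_d}$ is a trajectory of the system; $U=[u^d_1\cdots u^d_{N_d-1}]$, $U^p=[p^d_1\otimes u^d_1\cdots p^d_{N_d-1}\otimes u^d_{N_d-1}]$, $X=[x^d_1\cdots x^d_{N_d-1}]$, $X^p=[p^d_1\otimes x^d_1\cdots p^d_{N_d-1}\otimes x^d_{N_d-1}]$, $X_+=[x^d_2\cdots x^d_{N_d}]$, $\mathcal{D}_p=[X^\top\ (X^p)^\top\ U^\top\ (U^p)^\top]^\top$. "Stabilizes" means the closed loop $x_{k+1}=(A(p_k)+B(p_k)K(p_k))x_k$ is asymptotically stable for all scheduling trajectories with values in $\mathbb{P}$. Full-block LMI conditions for given $(\Delta(p),W,L_{11},L_{12},L_{21},L_{22})$ and symmetric multiplier $\Xi$: $\begin{bmatrix}L_{11}&L_{12}\\ I&0\end{bmatrix}^\top\Xi\begin{bmatrix}L_{11}&L_{12}\\ I&0\end{bmatrix}-\begin{bmatrix}L_{21}&L_{22}\end{bmatrix}^\top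 W\begin{bmatrix}L_{21}&L_{22}\end{bmatrix}\prec0$ and $\begin{bmatrix}I\\ \Delta(p)\end{bmatrix}^\top\Xi\begin{bmatrix}I\\ \Delta(p)\end{bmatrix}\succeq0$ for all $p\in\mathbb{P}$. *)

theory Defs
  imports "HOL-Analysis.Analysis" "Jordan_Normal_Form.Matrix" "Jordan_Normal_Form.DL_Rank"
begin

definition kron :: "real mat \<Rightarrow> real mat \<Rightarrow> real mat" where
  "kron A B = mat (dim_row A * dim_row B) (dim_col A * dim_col B)
     (\<lambda>(i,j). A $$ (i div dim_row B, j div dim_col B) * B $$ (i mod dim_row B, j mod dim_col B))"

definition col_mat :: "real vec \<Rightarrow> real mat" where
  "col_mat v = mat (dim_vec v) 1 (\<lambda>(i,j). v $ i)"

definition ones_mat :: "nat \<Rightarrow> real mat" where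
  "ones_mat n = mat n 1 (\<lambda>_. 1)"

definition hcat :: "real mat \<Rightarrow> real mat \<Rightarrow> real mat" where
  "hcat A B = four_block_mat A B (0\<^sub>m 0 (dim_col A)) (0\<^sub>m 0 (dim_col B))"

definition vcat :: "real mat \<Rightarrow> real mat \<Rightarrow> real mat" where
  "vcat A B = four_block_mat A (0\<^sub>m (dim_row A) 0) B (0\<^sub>m (dim_row B) 0)"

definition blkdiag :: "real mat \<Rightarrow> real mat \<Rightarrow> real mat" where
  "blkdiag A B = four_block_mat A (0\<^sub>m (dim_row A) (dim_col B)) (0\<^sub>m (dim_row B) (dim_col A)) B"

definition diag_vec :: "real vec \<Rightarrow> real mat" where
  "diag_vec p = mat (dim_vec p) (dim_vec p) (\<lambda>(i,j). if i = j then p $ i else 0)"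

definition cols_mat :: "nat \<Rightarrow> real vec list \<Rightarrow> real mat" where
  "cols_mat n vs = mat_of_cols n vs"

definition sym_mat :: "nat \<Rightarrow> real mat \<Rightarrow> bool" where
  "sym_mat n A \<longleftrightarrow> A \<in> carrier_mat n n \<and> transpose_mat A = A"

definition pos_def :: "real mat \<Rightarrow> bool" where
  "pos_def A \<longleftrightarrow> square_mat A \<and>
     (\<forall>v \<in> carrier_vec (dim_row A). v \<noteq> 0\<^sub>v (dim_row A) \<longrightarrow> v \<bullet> (A *\<^sub>v v) > 0)"

definition neg_def :: "real mat \<Rightarrow> bool" where
  "neg_def A \<longleftrightarrow> square_mat A \<and>
     (\<forall>v \<in> carrier_vec (dim_row A). v \<noteq> 0\<^sub>v (dim_row A) \<longrightarrow> v \<bullet> (A *\<^sub>v v) < 0)"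

definition pos_semidef :: "real mat \<Rightarrow> bool" where
  "pos_semidef A \<longleftrightarrow> square_mat A \<and>
     (\<forall>v \<in> carrier_vec (dim_row A). v \<bullet> (A *\<^sub>v v) \<ge> 0)"

text \<open>Embedding of a vector into nat => real (zero beyond its dimension); compactness
  of a set of n_p-dimensional vectors is compactness of its image (product topology),
  which coincides with compactness in R^n_p.\<close>
definition vec_fun :: "real vec \<Rightarrow> (nat \<Rightarrow> real)" where
  "vec_fun v = (\<lambda>i. if i < dim_vec v then v $ i else 0)"

definition sched_set :: "nat \<Rightarrow> real vec set \<Rightarrow> bool" where
  "sched_set np PP \<longleftrightarrow> PP \<subseteq> carrier_vec np \<and> compact (vec_fun ` PP) \<and>
     (\<forall>p\<in>PP. \<forall>q\<in>PP. \<forall>t::real. 0 \<le> t \<and> t \<le> 1 \<longrightarrow> t \<cdot>\<^sub>v p + (1 - t) \<cdot>\<^sub>v q \<in> PP)"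

text \<open>Affine parameter dependence M(p) = M_0 + sum_i p_i M_i (p indexed 0..n_p-1,
  so p_i of the paper is p $ (i-1)).\<close>
definition affine_mat :: "nat \<Rightarrow> nat \<Rightarrow> nat \<Rightarrow> (nat \<Rightarrow> real mat) \<Rightarrow> real vec \<Rightarrow> real mat" where
  "affine_mat np r c M p = mat r c (\<lambda>ij. M 0 $$ ij + (\<Sum>i\<in>{1..np}. p $ (i - 1) * M i $$ ij))"

fun cl_traj :: "nat \<Rightarrow> nat \<Rightarrow> nat \<Rightarrow> (nat \<Rightarrow> real mat) \<Rightarrow> (nat \<Rightarrow> real mat) \<Rightarrow> (nat \<Rightarrow> real mat)
    \<Rightarrow> (nat \<Rightarrow> real vec) \<Rightarrow> real vec \<Rightarrow> nat \<Rightarrow> real vec" where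
  "cl_traj np nx nu A B K p x0 0 = x0"
| "cl_traj np nx nu A B K p x0 (Suc k) =
     (affine_mat np nx nx A (p k) + affine_mat np nx nu B (p k) * affine_mat np nu nx K (p k))
       *\<^sub>v cl_traj np nx nu A B K p x0 k"

definition vnorm :: "real vec \<Rightarrow> real" where
  "vnorm v = sqrt (v \<bullet> v)"

definition stabilizes :: "nat \<Rightarrow> nat \<Rightarrow> nat \<Rightarrow> real vec set \<Rightarrow> (nat \<Rightarrow> real mat)
    \<Rightarrow> (nat \<Rightarrow> real mat) \<Rightarrow> (nat \<Rightarrow> real mat) \<Rightarrow> bool" where
  "stabilizes np nx nu PP A B K \<longleftrightarrow>
     (\<forall>p. (\<forall>k. p k \<in> PP) \<longrightarrow>
        (\<forall>\<epsilon>>0. \<exists>\<delta>>0. \<forall>x0\<in>carrier_vec nx. vnorm x0 < \<delta> \<longrightarrow>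
            (\<forall>k. vnorm (cl_traj np nx nu A B K p x0 k) < \<epsilon>)) \<and>
        (\<forall>x0\<in>carrier_vec nx. (\<lambda>k. vnorm (cl_traj np nx nu A B K p x0 k)) \<longlonglongrightarrow> 0))"

definition kron_vec :: "real vec \<Rightarrow> real vec \<Rightarrow> real vec" where
  "kron_vec v w = col (kron (col_mat v) (col_mat w)) 0"

text \<open>Data indexed k = 1..N_d.\<close>
definition dataU :: "nat \<Rightarrow> nat \<Rightarrow> (nat \<Rightarrow> real vec) \<Rightarrow> real mat" where
  "dataU Nd nu ud = mat_of_cols nu (map ud [1..<Nd])"

definition dataUp :: "nat \<Rightarrow> nat \<Rightarrow> nat \<Rightarrow> (nat \<Rightarrow> real vec) \<Rightarrow> (nat \<Rightarrow> real vec) \<Rightarrow> real mat" where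
  "dataUp Nd np nu pd ud = mat_of_cols (np * nu) (map (\<lambda>k. kron_vec (pd k) (ud k)) [1..<Nd])"

definition dataXplus :: "nat \<Rightarrow> nat \<Rightarrow> (nat \<Rightarrow> real vec) \<Rightarrow> real mat" where
  "dataXplus Nd nx xd = mat_of_cols nx (map xd [2..<Suc Nd])"

definition dataDp :: "nat \<Rightarrow> nat \<Rightarrow> nat \<Rightarrow> nat \<Rightarrow> (nat \<Rightarrow> real vec) \<Rightarrow> (nat \<Rightarrow> real vec)
    \<Rightarrow> (nat \<Rightarrow> real vec) \<Rightarrow> real mat" where
  "dataDp Nd np nx nu ud pd xd =
     vcat (dataU Nd nx xd) (vcat (dataUp Nd np nx pd xd) (vcat (dataU Nd nu ud) (dataUp Nd np nu pd ud)))"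

definition hcat_list :: "nat \<Rightarrow> real mat list \<Rightarrow> real mat" where
  "hcat_list r Ms = foldr hcat Ms (0\<^sub>m r 0)"

definition Kbar :: "nat \<Rightarrow> nat \<Rightarrow> (nat \<Rightarrow> real mat) \<Rightarrow> real mat" where
  "Kbar np nu K = hcat_list nu (map K [1..<Suc np])"

definition M_CL :: "nat \<Rightarrow> nat \<Rightarrow> nat \<Rightarrow> (nat \<Rightarrow> real mat) \<Rightarrow> real mat" where
  "M_CL np nx nu K =
    vcat (hcat (1\<^sub>m nx) (hcat (0\<^sub>m nx (np * nx)) (0\<^sub>m nx (np * np * nx))))
   (vcat (hcat (0\<^sub>m (np * nx) nx) (hcat (kron (1\<^sub>m np) (1\<^sub>m nx)) (0\<^sub>m (np * nx) (np * np * nx))))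
   (vcat (hcat (K 0) (hcat (Kbar np nu K) (0\<^sub>m nu (np * np * nx))))
         (hcat (0\<^sub>m (np * nu) nx) (hcat (kron (1\<^sub>m np) (K 0)) (kron (1\<^sub>m np) (Kbar np nu K))))))"

definition P_blk :: "nat \<Rightarrow> real mat \<Rightarrow> real mat" where
  "P_blk np P = blkdiag P (blkdiag (kron (1\<^sub>m np) P) (kron (1\<^sub>m np) (kron (1\<^sub>m np) P)))"

definition Pi3 :: "nat \<Rightarrow> real vec \<Rightarrow> real mat" where
  "Pi3 n p = vcat (1\<^sub>m n) (vcat (kron (col_mat p) (1\<^sub>m n)) (kron (col_mat p) (kron (col_mat p) (1\<^sub>m n))))"

definition Pi2 :: "nat \<Rightarrow> real vec \<Rightarrow> real mat" where
  "Pi2 n p = vcat (1\<^sub>m n) (kron (col_mat p) (1\<^sub>m n))"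

definition W_mat :: "nat \<Rightarrow> nat \<Rightarrow> real mat \<Rightarrow> real mat \<Rightarrow> real mat \<Rightarrow> real mat" where
  "W_mat np nx P Xp FQ =
     (let P0 = blkdiag P (0\<^sub>m (nx * np) (nx * np));
          XX = blkdiag Xp (kron (1\<^sub>m np) Xp)
      in four_block_mat P0 (XX * FQ) (transpose_mat (XX * FQ)) P0)"

definition Delta :: "nat \<Rightarrow> real vec \<Rightarrow> real mat" where
  "Delta nx p = kron (diag_vec p) (1\<^sub>m (2 * nx))"

definition L11 :: "nat \<Rightarrow> nat \<Rightarrow> real mat" where
  "L11 np nx = 0\<^sub>m (2 * nx * np) (2 * nx * np)"

definition L12 :: "nat \<Rightarrow> nat \<Rightarrow> real mat" where
  "L12 np nx = kron (ones_mat np) (1\<^sub>m (2 * nx))"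

definition E1 :: "nat \<Rightarrow> real mat" where "E1 nx = hcat (1\<^sub>m nx) (0\<^sub>m nx nx)"
definition E2 :: "nat \<Rightarrow> real mat" where "E2 nx = hcat (0\<^sub>m nx nx) (1\<^sub>m nx)"

definition L21 :: "nat \<Rightarrow> nat \<Rightarrow> real mat" where
  "L21 np nx = vcat (0\<^sub>m nx (2 * nx * np)) (vcat (kron (1\<^sub>m np) (E1 nx))
     (vcat (0\<^sub>m nx (2 * nx * np)) (kron (1\<^sub>m np) (E2 nx))))"

definition L22 :: "nat \<Rightarrow> nat \<Rightarrow> real mat" where
  "L22 np nx = vcat (E1 nx) (vcat (kron (ones_mat np) (0\<^sub>m nx (2 * nx)))
     (vcat (E2 nx) (kron (ones_mat np) (0\<^sub>m nx (2 * nx)))))"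

definition full_block_LMI :: "real vec set \<Rightarrow> (real vec \<Rightarrow> real mat) \<Rightarrow> real mat \<Rightarrow> real mat
    \<Rightarrow> real mat \<Rightarrow> real mat \<Rightarrow> real mat \<Rightarrow> real mat \<Rightarrow> bool" where
  "full_block_LMI PP Dl W La Lb Lc Ld Xi \<longleftrightarrow>
     (let Lup = four_block_mat La Lb (1\<^sub>m (dim_row La)) (0\<^sub>m (dim_row La) (dim_col Lb));
          Llo = hcat Lc Ld
      in neg_def (transpose_mat Lup * Xi * Lup - transpose_mat Llo * W * Llo)) \<and>
     (\<forall>p\<in>PP. pos_semidef (transpose_mat (vcat (1\<^sub>m (dim_row (Dl p))) (Dl p)) * Xi
                               * vcat (1\<^sub>m (dim_row (Dl p))) (Dl p)))"

end

theory Submission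
  imports Defs
begin

text \<open>
  The strict inequality of the full-block LMI does not depend on \<open>p\<close>, so it holds with a margin
  \<open>\<epsilon>\<close>. Testing it on the vectors \<open>(p \<otimes> w, w)\<close>, on which the multiplier term is nonnegative, and
  using the data equations to recognise \<open>\<X>\<^sub>+ F\<^sub>Q\<close> as \<open>Y(p) P\<close> for the closed-loop matrix \<open>Y(p)\<close>, gives
  \<open>x\<^sup>T P x + 2 x\<^sup>T Y(p) P y + y\<^sup>T P y \<ge> \<epsilon> |x|\<^sup>2\<close> for all \<open>p\<close>, \<open>x\<close>, \<open>y\<close>. The choice
  \<open>y = - Y(p)\<^sup>T x\<close> shows that the transposed closed loop contracts the form \<open>w\<^sup>T P w\<close> by a factor
  \<open>\<rho> < 1\<close> that is uniform in \<open>p\<close>. Expanding \<open>x\<^sub>k\<^sup>T w = x\<^sub>0\<^sup>T Y(p\<^sub>0)\<^sup>T \<cdots> Y(p\<^sub>k\<^sub>-\<^sub>1)\<^sup>T w\<close> at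
  \<open>w = x\<^sub>k\<close> turns this dual contraction into geometric decay of \<open>|x\<^sub>k|\<close>, without inverting \<open>P\<close>.
\<close>

unbundle no inner_syntax and no vec_syntax

section \<open>Block matrices and Kronecker products\<close>

lemma vcat_carrier [simp, intro]:
  "A \<in> carrier_mat a n \<Longrightarrow> B \<in> carrier_mat b n \<Longrightarrow> vcat A B \<in> carrier_mat (a + b) n"
  unfolding vcat_def by auto

lemma hcat_carrier [simp, intro]:
  "A \<in> carrier_mat n a \<Longrightarrow> B \<in> carrier_mat n b \<Longrightarrow> hcat A B \<in> carrier_mat n (a + b)"
  unfolding hcat_def by auto

lemma blkdiag_carrier [simp, intro]:
  "A \<in> carrier_mat a c \<Longrightarrow> B \<in> carrier_mat b d \<Longrightarrow> blkdiag A B \<in> carrier_mat (a + b) (c + d)"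
  unfolding blkdiag_def by auto

lemma kron_carrier [simp, intro]:
  "A \<in> carrier_mat a c \<Longrightarrow> B \<in> carrier_mat b d \<Longrightarrow> kron A B \<in> carrier_mat (a * b) (c * d)"
  unfolding kron_def by auto

lemma col_mat_carrier [simp, intro]: "v \<in> carrier_vec n \<Longrightarrow> col_mat v \<in> carrier_mat n 1"
  unfolding col_mat_def by auto

lemma kron_col_mat_carrier [simp, intro]:
  "v \<in> carrier_vec n \<Longrightarrow> A \<in> carrier_mat r c \<Longrightarrow> kron (col_mat v) A \<in> carrier_mat (n * r) c"
  using kron_carrier[of "col_mat v" n 1 A r c] col_mat_carrier[of v n] by simp

lemma ones_mat_carrier [simp, intro]: "ones_mat n \<in> carrier_mat n 1"
  unfolding ones_mat_def by auto

lemma diag_vec_carrier [simp, intro]: "p \<in> carrier_vec n \<Longrightarrow> diag_vec p \<in> carrier_mat n n"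
  unfolding diag_vec_def by auto

lemma vcat_mult:
  assumes "A \<in> carrier_mat a n" "B \<in> carrier_mat b n" "C \<in> carrier_mat n c"
  shows "vcat A B * C = vcat (A * C) (B * C)"
  using assms unfolding vcat_def
  by (intro eq_matI) (auto simp: scalar_prod_def row_def col_def)

text \<open>\<open>hcat\<close> and \<open>vcat\<close> are four-block matrices with two empty
  blocks each, so this is the general four-block product rule; three of the four resulting blocks
  have no rows or no columns and disappear.\<close>

lemma hcat_mult_vcat:
  assumes "A \<in> carrier_mat r a" "B \<in> carrier_mat r b" "C \<in> carrier_mat a c" "D \<in> carrier_mat b c"
  shows "hcat A B * vcat C D = A * C + B * D"
proof -
  have "hcat A B * vcat C D = four_block_mat (A * C + B * D) (A * 0\<^sub>m a 0 + B * 0\<^sub>m b 0)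
      (0\<^sub>m 0 a * C + 0\<^sub>m 0 b * D) (0\<^sub>m 0 a * 0\<^sub>m a 0 + 0\<^sub>m 0 b * 0\<^sub>m b 0)"
    using assms unfolding hcat_def vcat_def
    by (subst mult_four_block_mat[of _ r a _ b _ 0 _ _ c _ 0]) auto
  also have "\<dots> = A * C + B * D"
    using assms by (intro eq_matI) auto
  finally show ?thesis .
qed

lemma blkdiag_mult_vcat:
  assumes "A \<in> carrier_mat r a" "B \<in> carrier_mat s b" "C \<in> carrier_mat a c" "D \<in> carrier_mat b c"
  shows "blkdiag A B * vcat C D = vcat (A * C) (B * D)"
proof -
  have "blkdiag A B * vcat C D = four_block_mat (A * C + 0\<^sub>m r b * D) (A * 0\<^sub>m a 0 + 0\<^sub>m r b * 0\<^sub>m b 0)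
      (0\<^sub>m s a * C + B * D) (0\<^sub>m s a * 0\<^sub>m a 0 + B * 0\<^sub>m b 0)"
    using assms unfolding blkdiag_def vcat_def
    by (subst mult_four_block_mat[of _ r a _ b _ s _ _ c _ 0]) auto
  also have "\<dots> = vcat (A * C) (B * D)"
    using assms unfolding vcat_def by (intro cong_four_block_mat) auto
  finally show ?thesis .
qed

lemma vcat_assoc:
  assumes "A \<in> carrier_mat a n" "B \<in> carrier_mat b n" "C \<in> carrier_mat c n"
  shows "vcat (vcat A B) C = vcat A (vcat B C)"
  using assms unfolding vcat_def by (intro eq_matI) auto

lemma vcat_add:
  assumes "A \<in> carrier_mat a n" "B \<in> carrier_mat b n" "C \<in> carrier_mat a n" "D \<in> carrier_mat b n"
  shows "vcat A B + vcat C D = vcat (A + C) (B + D)"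
  using assms unfolding vcat_def by (intro eq_matI) auto

lemma vcat_mult_vec:
  assumes "A \<in> carrier_mat a n" "B \<in> carrier_mat b n" "x \<in> carrier_vec n"
  shows "vcat A B *\<^sub>v x = (A *\<^sub>v x) @\<^sub>v (B *\<^sub>v x)"
  using assms unfolding vcat_def
  by (intro eq_vecI) (auto simp: scalar_prod_def row_def)

lemma hcat_mult_append:
  assumes "A \<in> carrier_mat n a" "B \<in> carrier_mat n b" "x \<in> carrier_vec a" "y \<in> carrier_vec b"
  shows "hcat A B *\<^sub>v (x @\<^sub>v y) = A *\<^sub>v x + B *\<^sub>v y"
proof -
  have "hcat A B *\<^sub>v (x @\<^sub>v y) = (A *\<^sub>v x + B *\<^sub>v y) @\<^sub>v (0\<^sub>m 0 a *\<^sub>v x + 0\<^sub>m 0 b *\<^sub>v y)"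
    using assms unfolding hcat_def
    by (subst four_block_mat_mult_vec[of _ n a _ b _ 0]) auto
  also have "\<dots> = A *\<^sub>v x + B *\<^sub>v y" using assms by (intro eq_vecI) auto
  finally show ?thesis .
qed

section \<open>Index arithmetic and the calculus of Kronecker products\<close>

lemma div_mod_less:
  fixes i :: nat assumes "i < a * b"
  shows "i div b < a" "i mod b < b"
proof -
  show "i div b < a" using assms by (rule less_mult_imp_div_less)
  have "b > 0" using assms by (cases b) auto
  then show "i mod b < b" by simp
qed

text \<open>Row-major enumeration k = i * n + j cuts the range into m blocks of length n. Inner sums
  over a Kronecker index thereby become double sums.\<close>

lemma sum_div_mod:
  fixes f :: "nat \<Rightarrow> nat \<Rightarrow> real"
  shows "(\<Sum>k<m * n. f (k div n) (k mod n)) = (\<Sum>i<m. \<Sum>j<n. f i j)"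
proof -
  have "(\<Sum>k<m * n. f (k div n) (k mod n)) = (\<Sum>i<m. \<Sum>k=i*n..<i*n+n. f (k div n) (k mod n))"
    by (rule sum.nat_group[symmetric])
  also have "\<dots> = (\<Sum>i<m. \<Sum>j<n. f i j)"
  proof (rule sum.cong[OF refl])
    fix i
    have "(\<Sum>k=0+i*n..<n+i*n. f (k div n) (k mod n)) = (\<Sum>j=0..<n. f ((j+i*n) div n) ((j+i*n) mod n))"
      by (rule sum.shift_bounds_nat_ivl)
    also have "\<dots> = (\<Sum>j<n. f i j)"
      by (rule sum.cong) auto
    finally show "(\<Sum>k=i*n..<i*n+n. f (k div n) (k mod n)) = (\<Sum>j<n. f i j)"
      by (simp add: add.commute)
  qed
  finally show ?thesis .
qed

lemma kron_index:
  assumes "A \<in> carrier_mat a c" "B \<in> carrier_mat b d" "i < a * b" "j < c * d"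
  shows "kron A B $$ (i, j) = A $$ (i div b, j div d) * B $$ (i mod b, j mod d)"
  using assms unfolding kron_def by auto

text \<open>The mixed-product property. Writing the summation index as a pair (k div d, k mod d)
  separates the summand into a factor for A, C and a factor for B, D; distributivity then splits the
  double sum into a product of two entries.\<close>

lemma kron_mult:
  assumes A: "A \<in> carrier_mat a c" and B: "B \<in> carrier_mat b d"
    and C: "C \<in> carrier_mat c e" and D: "D \<in> carrier_mat d f"
  shows "kron A B * kron C D = kron (A * C) (B * D)"
proof (rule eq_matI)
  fix i j assume "i < dim_row (kron (A * C) (B * D))" "j < dim_col (kron (A * C) (B * D))"
  then have ij: "i < a * b" "j < e * f" using assms by (auto simp: kron_def)
  note lt = div_mod_less[OF ij(1)] div_mod_less[OF ij(2)]
  have "(kron A B * kron C D) $$ (i, j) = (\<Sum>k<c * d. kron A B $$ (i, k) * kron C D $$ (k, j))"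
    using ij kron_carrier[OF A B] kron_carrier[OF C D]
    by (simp add: scalar_prod_def lessThan_atLeast0)
  also have "\<dots> = (\<Sum>k<c * d. (A $$ (i div b, k div d) * C $$ (k div d, j div f)) *
      (B $$ (i mod b, k mod d) * D $$ (k mod d, j mod f)))"
    by (rule sum.cong) (auto simp: kron_index[OF A B ij(1)] kron_index[OF C D _ ij(2)])
  also have "\<dots> = (\<Sum>k<c. \<Sum>l<d. (A $$ (i div b, k) * C $$ (k, j div f)) *
      (B $$ (i mod b, l) * D $$ (l, j mod f)))"
    by (rule sum_div_mod)
  also have "\<dots> = (A * C) $$ (i div b, j div f) * (B * D) $$ (i mod b, j mod f)"
    using assms lt by (simp add: scalar_prod_def lessThan_atLeast0 sum_product)
  also have "\<dots> = kron (A * C) (B * D) $$ (i, j)"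
    using assms ij by (subst kron_index[of _ a e _ b f]) auto
  finally show "(kron A B * kron C D) $$ (i, j) = kron (A * C) (B * D) $$ (i, j)" .
qed (use assms in \<open>auto simp: kron_def\<close>)

lemma transpose_kron: "transpose_mat (kron A B) = kron (transpose_mat A) (transpose_mat B)"
proof (rule eq_matI)
  fix i j assume ij: "i < dim_row (kron (transpose_mat A) (transpose_mat B))"
    "j < dim_col (kron (transpose_mat A) (transpose_mat B))"
  then have "i < dim_col A * dim_col B" "j < dim_row A * dim_row B" by (auto simp: kron_def)
  note this div_mod_less[OF this(1)] div_mod_less[OF this(2)]
  then show "transpose_mat (kron A B) $$ (i, j) = kron (transpose_mat A) (transpose_mat B) $$ (i, j)"
    by (simp add: kron_def)
qed (auto simp: kron_def)

lemma kron_one_left: "kron (1\<^sub>m 1) A = A"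
  by (rule eq_matI) (auto simp: kron_def)

lemma kron_zero_right: "kron A (0\<^sub>m r c) = 0\<^sub>m (dim_row A * r) (dim_col A * c)"
  by (rule eq_matI) (auto simp: kron_def div_mod_less)

lemma kron_add_right:
  assumes "A \<in> carrier_mat a c" "B \<in> carrier_mat b d" "C \<in> carrier_mat b d"
  shows "kron A (B + C) = kron A B + kron A C"
proof (rule eq_matI)
  fix i j assume "i < dim_row (kron A B + kron A C)" "j < dim_col (kron A B + kron A C)"
  then have ij: "i < a * b" "j < c * d" using assms by (auto simp: kron_def)
  note lt = div_mod_less[OF ij(1)] div_mod_less[OF ij(2)]
  have "kron A (B + C) $$ (i, j) = A $$ (i div b, j div d) * (B + C) $$ (i mod b, j mod d)"
    using assms ij by (intro kron_index) auto
  also have "\<dots> = kron A B $$ (i, j) + kron A C $$ (i, j)"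
    using assms lt kron_index[OF assms(1,2) ij] kron_index[OF assms(1,3) ij]
    by (simp add: distrib_left)
  also have "\<dots> = (kron A B + kron A C) $$ (i, j)"
    using assms ij by (auto simp: kron_def)
  finally show "kron A (B + C) $$ (i, j) = (kron A B + kron A C) $$ (i, j)" .
qed (use assms in \<open>auto simp: kron_def\<close>)

text \<open>The two instances of the mixed-product rule on which the scheduling algebra rests; in
  the first, M is read as \<open>kron (1\<^sub>m 1) M\<close>. They move a factor p \<otimes> past
  matrices that do not depend on p.\<close>

lemma kron_col_mult:
  assumes "p \<in> carrier_vec n" "A \<in> carrier_mat r s" "M \<in> carrier_mat s m"
  shows "kron (col_mat p) A * M = kron (col_mat p) (A * M)"
    and "kron (1\<^sub>m n) A * kron (col_mat p) M = kron (col_mat p) (A * M)"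
proof -
  have p: "col_mat p \<in> carrier_mat n 1" using assms by (intro col_mat_carrier)
  have "kron (col_mat p) A * kron (1\<^sub>m 1) M = kron (col_mat p * 1\<^sub>m 1) (A * M)"
    by (rule kron_mult[OF p assms(2) one_carrier_mat assms(3)])
  then show "kron (col_mat p) A * M = kron (col_mat p) (A * M)"
    by (simp only: kron_one_left right_mult_one_mat[OF p])
  have "kron (1\<^sub>m n) A * kron (col_mat p) M = kron (1\<^sub>m n * col_mat p) (A * M)"
    by (rule kron_mult[OF one_carrier_mat assms(2) p assms(3)])
  then show "kron (1\<^sub>m n) A * kron (col_mat p) M = kron (col_mat p) (A * M)"
    by (simp only: left_mult_one_mat[OF p])
qed

lemma diag_vec_mult_ones: "p \<in> carrier_vec n \<Longrightarrow> diag_vec p * ones_mat n = col_mat p"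
  by (rule eq_matI)
    (auto simp: diag_vec_def ones_mat_def col_mat_def scalar_prod_def row_def mult_delta_right)

section \<open>Affine dependence through concatenated coefficients\<close>

lemma hcat_list_carrier:
  assumes "\<forall>M\<in>set Ms. M \<in> carrier_mat r c"
  shows "hcat_list r Ms \<in> carrier_mat r (length Ms * c)"
  using assms by (induction Ms) (auto simp: hcat_list_def)

lemma hcat_list_index:
  assumes "\<forall>M\<in>set Ms. M \<in> carrier_mat r c" "i < r" "j < length Ms * c"
  shows "hcat_list r Ms $$ (i, j) = (Ms ! (j div c)) $$ (i, j mod c)"
  using assms
proof (induction Ms arbitrary: j)
  case (Cons M Ms)
  have c: "M \<in> carrier_mat r c" "hcat_list r Ms \<in> carrier_mat r (length Ms * c)"
    using Cons.prems hcat_list_carrier[of Ms r c] by auto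
  have *: "hcat_list r (M # Ms) = hcat M (hcat_list r Ms)" by (simp add: hcat_list_def)
  show ?case
  proof (cases "j < c")
    case True
    then show ?thesis using c Cons.prems unfolding * hcat_def by (subst index_mat_four_block) auto
  next
    case False
    with Cons.prems have "c > 0" by (cases c) auto
    then have "j div c = Suc ((j - c) div c)" "j mod c = (j - c) mod c"
      using False by (simp_all add: le_div_geq le_mod_geq)
    then show ?thesis using c Cons.prems Cons.IH[of "j - c"] False unfolding * hcat_def
      by (subst index_mat_four_block) auto
  qed
qed simp

lemma Kbar_carrier:
  assumes "\<forall>i\<le>np. M i \<in> carrier_mat r c"
  shows "Kbar np r M \<in> carrier_mat r (np * c)"
  using hcat_list_carrier[of "map M [1..<Suc np]" r c] assms unfolding Kbar_def by auto

text \<open>The sum of the p_i M_i is [M_1 ... M_np] (p \<otimes> I). This puts the unknown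
  coefficients into one constant matrix and all dependence on p into a known factor.\<close>

lemma affine_mat_eq:
  assumes M: "\<forall>i\<le>np. M i \<in> carrier_mat r c" and p: "p \<in> carrier_vec np"
  shows "affine_mat np r c M p = M 0 + Kbar np r M * kron (col_mat p) (1\<^sub>m c)"
proof (rule eq_matI)
  have K: "Kbar np r M \<in> carrier_mat r (np * c)" using M by (rule Kbar_carrier)
  have k: "kron (col_mat p) (1\<^sub>m c) \<in> carrier_mat (np * c) c"
    using p by simp
  have M0: "M 0 \<in> carrier_mat r c" using M by simp
  fix i j assume "i < dim_row (M 0 + Kbar np r M * kron (col_mat p) (1\<^sub>m c))"
    "j < dim_col (M 0 + Kbar np r M * kron (col_mat p) (1\<^sub>m c))"
  then have ij: "i < r" "j < c" using K k by auto
  have "(Kbar np r M * kron (col_mat p) (1\<^sub>m c)) $$ (i, j)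
      = (\<Sum>k<np * c. Kbar np r M $$ (i, k) * kron (col_mat p) (1\<^sub>m c) $$ (k, j))"
    using ij K k by (simp add: scalar_prod_def lessThan_atLeast0)
  \<comment> \<open>\<open>Kbar\<close> starts with M 1 at block position 0, hence
    \<open>Suc (k div c)\<close>, while p is indexed from 0. The entry of p \<otimes> I in row k
    survives only for k mod c = j.\<close>
  also have "\<dots> = (\<Sum>k<np * c. M (Suc (k div c)) $$ (i, k mod c) * (p $ (k div c) * (if k mod c = j then 1 else 0)))"
  proof (rule sum.cong[OF refl])
    fix k assume "k \<in> {..<np * c}"
    then have k: "k < np * c" by simp
    note lt = div_mod_less[OF k]
    have "Kbar np r M $$ (i, k) = M (Suc (k div c)) $$ (i, k mod c)"
      unfolding Kbar_def using M ij k lt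
      by (subst hcat_list_index[of _ _ c]) (auto simp del: upt_Suc)
    moreover have "kron (col_mat p) (1\<^sub>m c) $$ (k, j) = p $ (k div c) * (if k mod c = j then 1 else 0)"
      using kron_index[of "col_mat p" np 1 "1\<^sub>m c" c c k j] p ij k lt by (simp add: col_mat_def)
    ultimately show "Kbar np r M $$ (i, k) * kron (col_mat p) (1\<^sub>m c) $$ (k, j)
      = M (Suc (k div c)) $$ (i, k mod c) * (p $ (k div c) * (if k mod c = j then 1 else 0))" by simp
  qed
  also have "\<dots> = (\<Sum>k<np. \<Sum>l<c. M (Suc k) $$ (i, l) * (p $ k * (if l = j then 1 else 0)))"
    by (rule sum_div_mod)
  also have "\<dots> = (\<Sum>k<np. p $ k * M (Suc k) $$ (i, j))"
    using ij by (intro sum.cong) (auto simp: mult_delta_right mult.commute)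
  also have "\<dots> = (\<Sum>k\<in>{1..np}. p $ (k - 1) * M k $$ (i, j))"
    by (simp add: sum.atLeast1_atMost_eq)
  finally show "affine_mat np r c M p $$ (i, j) = (M 0 + Kbar np r M * kron (col_mat p) (1\<^sub>m c)) $$ (i, j)"
    using ij M0 K k by (simp add: affine_mat_def)
qed (use M p Kbar_carrier[OF M] in \<open>auto simp: affine_mat_def kron_def col_mat_def\<close>)

section \<open>Data-based representation of the closed loop\<close>

lemma Pi2_carrier [simp, intro]: "p \<in> carrier_vec np \<Longrightarrow> Pi2 n p \<in> carrier_mat (n + np * n) n"
  unfolding Pi2_def by auto

lemma Pi3_carrier [simp, intro]:
  "p \<in> carrier_vec np \<Longrightarrow> Pi3 n p \<in> carrier_mat (n + (np * n + np * (np * n))) n"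
  unfolding Pi3_def by auto

lemma Pi3_mult:
  assumes p: "p \<in> carrier_vec np" and M: "M \<in> carrier_mat n m"
  shows "Pi3 n p * M = vcat M (vcat (kron (col_mat p) M) (kron (col_mat p) (kron (col_mat p) M)))"
proof -
  have c: "kron (col_mat p) (1\<^sub>m n) \<in> carrier_mat (np * n) n" using p by simp
  have "Pi3 n p * M = vcat (1\<^sub>m n * M) (vcat (kron (col_mat p) (1\<^sub>m n) * M)
      (kron (col_mat p) (kron (col_mat p) (1\<^sub>m n)) * M))"
    unfolding Pi3_def
    by (simp only: vcat_mult[OF one_carrier_mat vcat_carrier[OF c kron_col_mat_carrier[OF p c]] M]
        vcat_mult[OF c kron_col_mat_carrier[OF p c] M])
  then show ?thesis
    by (simp only: kron_col_mult(1)[OF p c M] kron_col_mult(1)[OF p one_carrier_mat M] left_mult_one_mat[OF M])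
qed

lemma Pi2_mult:
  assumes p: "p \<in> carrier_vec np" and M: "M \<in> carrier_mat n m"
  shows "Pi2 n p * M = vcat M (kron (col_mat p) M)"
proof -
  have c: "kron (col_mat p) (1\<^sub>m n) \<in> carrier_mat (np * n) n" using p by simp
  show ?thesis unfolding Pi2_def
    by (simp only: vcat_mult[OF one_carrier_mat c M] kron_col_mult(1)[OF p one_carrier_mat M] left_mult_one_mat[OF M])
qed

text \<open>Each block satisfies (I \<otimes> P)(p \<otimes> I) = p \<otimes> P = (p \<otimes> I) P.
  The repeated copies of P therefore collapse to a single right factor once the scheduling basis is
  applied.\<close>

lemma P_blk_mult_Pi3:
  assumes p: "p \<in> carrier_vec np" and P: "P \<in> carrier_mat n n"
  shows "P_blk np P * Pi3 n p = Pi3 n p * P"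
proof -
  have k: "kron (1\<^sub>m np) P \<in> carrier_mat (np * n) (np * n)" using P by simp
  have pI: "kron (col_mat p) (1\<^sub>m n) \<in> carrier_mat (np * n) n" using p by simp
  have 1: "kron (1\<^sub>m np) P * kron (col_mat p) (1\<^sub>m n) = kron (col_mat p) P"
    using kron_col_mult(2)[OF p P one_carrier_mat] P by simp
  have 2: "kron (1\<^sub>m np) (kron (1\<^sub>m np) P) * kron (col_mat p) (kron (col_mat p) (1\<^sub>m n))
      = kron (col_mat p) (kron (col_mat p) P)"
    unfolding kron_col_mult(2)[OF p k pI] 1 ..
  have "P_blk np P * Pi3 n p = vcat (P * 1\<^sub>m n) (vcat (kron (1\<^sub>m np) P * kron (col_mat p) (1\<^sub>m n))
      (kron (1\<^sub>m np) (kron (1\<^sub>m np) P) * kron (col_mat p) (kron (col_mat p) (1\<^sub>m n))))"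
    unfolding P_blk_def Pi3_def using p P
    by (subst blkdiag_mult_vcat[of _ n n _ "np * n + np * (np * n)" "np * n + np * (np * n)" _ n],
      simp, simp, simp, simp,
      subst blkdiag_mult_vcat[of _ "np * n" "np * n" _ "np * (np * n)" "np * (np * n)" _ n]) simp_all
  also have "\<dots> = Pi3 n p * P"
    using P by (simp add: 1 2 Pi3_mult[OF p P])
  finally show ?thesis .
qed

lemma hcat3_mult_Pi3:
  assumes "p \<in> carrier_vec np" "A \<in> carrier_mat r n" "B \<in> carrier_mat r (np * n)"
    "C \<in> carrier_mat r (np * np * n)"
  shows "hcat A (hcat B C) * Pi3 n p
    = A + (B * kron (col_mat p) (1\<^sub>m n) + C * kron (col_mat p) (kron (col_mat p) (1\<^sub>m n)))"
  using assms unfolding Pi3_def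
  by (subst hcat_mult_vcat[of _ r n _ "np * n + np * (np * n)" _ n],
      simp, simp add: mult.assoc, simp, simp,
      subst hcat_mult_vcat[of _ r "np * n" _ "np * (np * n)" _ n],
      simp_all add: mult.assoc)

lemma affine_mat_carrier [simp, intro]: "affine_mat np r c M p \<in> carrier_mat r c"
  unfolding affine_mat_def by simp

text \<open>Applied to x, the result lists x, p \<otimes> x, u and p \<otimes> u for the feedback u
  = K(p) x, in the row order of \<open>dataDp\<close>. The quadratic basis element p \<otimes> p
  \<otimes> I is needed for the last block, where p multiplies K(p), itself affine in p.\<close>

lemma M_CL_mult_Pi3:
  assumes p: "p \<in> carrier_vec np" and K: "\<forall>i\<le>np. K i \<in> carrier_mat nu nx"
  shows "M_CL np nx nu K * Pi3 nx p =
    vcat (1\<^sub>m nx) (vcat (kron (col_mat p) (1\<^sub>m nx))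
      (vcat (affine_mat np nu nx K p) (kron (col_mat p) (affine_mat np nu nx K p))))"
proof -
  let ?p = "col_mat p" and ?K = "affine_mat np nu nx K p"
  let ?pI = "kron ?p (1\<^sub>m nx)" and ?ppI = "kron ?p (kron ?p (1\<^sub>m nx))"
  have K0: "K 0 \<in> carrier_mat nu nx" using K by simp
  have Kb: "Kbar np nu K \<in> carrier_mat nu (np * nx)" using K by (rule Kbar_carrier)
  have pI: "?pI \<in> carrier_mat (np * nx) nx" using p by simp
  have ppI: "?ppI \<in> carrier_mat (np * np * nx) nx" using p by (simp add: mult.assoc)
  have z: "0\<^sub>m r (np * np * nx) * ?ppI = 0\<^sub>m r nx" for r using ppI by simp
  have z': "0\<^sub>m r (np * nx) * ?pI = 0\<^sub>m r nx" for r using pI by simp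
  have KpI: "Kbar np nu K * ?pI \<in> carrier_mat nu nx" using Kb pI by simp
  have aff: "?K = K 0 + Kbar np nu K * ?pI" by (rule affine_mat_eq[OF K p])
  have kKb: "kron (1\<^sub>m np) (Kbar np nu K) \<in> carrier_mat (np * nu) (np * np * nx)"
    using Kb by (simp add: mult.assoc)
  have 1: "hcat (1\<^sub>m nx) (hcat (0\<^sub>m nx (np * nx)) (0\<^sub>m nx (np * np * nx))) * Pi3 nx p = 1\<^sub>m nx"
    by (subst hcat3_mult_Pi3[OF p, where r = nx]) (simp_all add: z z')
  have 2: "hcat (0\<^sub>m (np * nx) nx) (hcat (kron (1\<^sub>m np) (1\<^sub>m nx)) (0\<^sub>m (np * nx) (np * np * nx))) * Pi3 nx p = ?pI"
    using pI by (subst hcat3_mult_Pi3[OF p, where r = "np * nx"]) (simp_all add: z kron_col_mult(2)[OF p one_carrier_mat one_carrier_mat])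
  have 3: "hcat (K 0) (hcat (Kbar np nu K) (0\<^sub>m nu (np * np * nx))) * Pi3 nx p = ?K"
    unfolding hcat3_mult_Pi3[OF p K0 Kb zero_carrier_mat] z aff using KpI by simp
  have "hcat (0\<^sub>m (np * nu) nx) (hcat (kron (1\<^sub>m np) (K 0)) (kron (1\<^sub>m np) (Kbar np nu K))) * Pi3 nx p
    = 0\<^sub>m (np * nu) nx + (kron (1\<^sub>m np) (K 0) * ?pI + kron (1\<^sub>m np) (Kbar np nu K) * ?ppI)"
    using K0 kKb by (subst hcat3_mult_Pi3[OF p]) simp_all
  also have "kron (1\<^sub>m np) (K 0) * ?pI = kron ?p (K 0)"
    using kron_col_mult(2)[OF p K0 one_carrier_mat] K0 by simp
  \<comment> \<open>Only the outer copy of p is pulled out; the inner p \<otimes> I stays with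
    \<open>Kbar\<close> and completes K(p).\<close>
  also have "kron (1\<^sub>m np) (Kbar np nu K) * ?ppI = kron ?p (Kbar np nu K * ?pI)"
    by (rule kron_col_mult(2)[OF p Kb pI])
  also have "kron ?p (K 0) + kron ?p (Kbar np nu K * ?pI) = kron ?p ?K"
    unfolding aff using p K0 KpI by (intro kron_add_right[symmetric]) auto
  also have "0\<^sub>m (np * nu) nx + kron ?p ?K = kron ?p ?K"
    using p by (intro left_add_zero_mat) auto
  finally have 4: "hcat (0\<^sub>m (np * nu) nx) (hcat (kron (1\<^sub>m np) (K 0)) (kron (1\<^sub>m np) (Kbar np nu K))) * Pi3 nx p
    = kron ?p ?K" .
  let ?n = "nx + (np * nx + np * np * nx)"
  have Pi: "Pi3 nx p \<in> carrier_mat ?n nx" using Pi3_carrier[OF p] by (simp add: mult.assoc)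
  have c: "hcat (1\<^sub>m nx) (hcat (0\<^sub>m nx (np * nx)) (0\<^sub>m nx (np * np * nx))) \<in> carrier_mat nx ?n"
    "hcat (0\<^sub>m (np * nx) nx) (hcat (kron (1\<^sub>m np) (1\<^sub>m nx)) (0\<^sub>m (np * nx) (np * np * nx))) \<in> carrier_mat (np * nx) ?n"
    "hcat (K 0) (hcat (Kbar np nu K) (0\<^sub>m nu (np * np * nx))) \<in> carrier_mat nu ?n"
    "hcat (0\<^sub>m (np * nu) nx) (hcat (kron (1\<^sub>m np) (K 0)) (kron (1\<^sub>m np) (Kbar np nu K))) \<in> carrier_mat (np * nu) ?n"
    using K0 Kb kKb by simp_all
  show ?thesis
    unfolding M_CL_def
    by (simp only: vcat_mult[OF c(1) vcat_carrier[OF c(2) vcat_carrier[OF c(3,4)]] Pi]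
        vcat_mult[OF c(2) vcat_carrier[OF c(3,4)] Pi] vcat_mult[OF c(3,4) Pi] 1 2 3 4)
qed

lemma M_CL_carrier:
  assumes K: "\<forall>i\<le>np. K i \<in> carrier_mat nu nx"
  shows "M_CL np nx nu K \<in> carrier_mat (nx + (np * nx + (nu + np * nu))) (nx + (np * nx + np * (np * nx)))"
proof -
  have "K 0 \<in> carrier_mat nu nx" using K by simp
  moreover have "Kbar np nu K \<in> carrier_mat nu (np * nx)" using K by (rule Kbar_carrier)
  ultimately show ?thesis unfolding M_CL_def mult.assoc by (intro vcat_carrier hcat_carrier) auto
qed

text \<open>The unknown system as one constant matrix, with its block columns ordered like the block
  rows of \<open>dataDp\<close>. \<open>Kbar\<close> serves here as plain concatenation of the
  coefficients with index 1 to np.\<close>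

definition sys_mat :: "nat \<Rightarrow> nat \<Rightarrow> (nat \<Rightarrow> real mat) \<Rightarrow> (nat \<Rightarrow> real mat) \<Rightarrow> real mat" where
  "sys_mat np nx A B = hcat (A 0) (hcat (Kbar np nx A) (hcat (B 0) (Kbar np nx B)))"

lemma sys_mat_carrier:
  assumes "\<forall>i\<le>np. A i \<in> carrier_mat nx nx" "\<forall>i\<le>np. B i \<in> carrier_mat nx nu"
  shows "sys_mat np nx A B \<in> carrier_mat nx (nx + (np * nx + (nu + np * nu)))"
  using assms Kbar_carrier[OF assms(1)] Kbar_carrier[OF assms(2)] unfolding sys_mat_def by auto

lemma sys_mat_mult:
  assumes A: "\<forall>i\<le>np. A i \<in> carrier_mat nx nx" and B: "\<forall>i\<le>np. B i \<in> carrier_mat nx nu"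
    and "X \<in> carrier_mat nx m" "Y \<in> carrier_mat (np * nx) m"
    and "U \<in> carrier_mat nu m" "V \<in> carrier_mat (np * nu) m"
  shows "sys_mat np nx A B * vcat X (vcat Y (vcat U V))
    = A 0 * X + (Kbar np nx A * Y + (B 0 * U + Kbar np nx B * V))"
proof -
  have c: "A 0 \<in> carrier_mat nx nx" "Kbar np nx A \<in> carrier_mat nx (np * nx)"
    "B 0 \<in> carrier_mat nx nu" "Kbar np nx B \<in> carrier_mat nx (np * nu)"
    using A B Kbar_carrier[OF A] Kbar_carrier[OF B] by auto
  show ?thesis
    unfolding sys_mat_def
    by (simp only: hcat_mult_vcat[OF c(1) hcat_carrier[OF c(2) hcat_carrier[OF c(3,4)]] assms(3) vcat_carrier[OF assms(4) vcat_carrier[OF assms(5,6)]]]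
       hcat_mult_vcat[OF c(2) hcat_carrier[OF c(3,4)] assms(4) vcat_carrier[OF assms(5,6)]]
       hcat_mult_vcat[OF c(3,4) assms(5,6)])
qed

section \<open>The data matrices and the system equation\<close>

lemma kron_vec_eq:
  assumes "p \<in> carrier_vec n" "x \<in> carrier_vec m"
  shows "kron_vec p x = kron (col_mat p) (1\<^sub>m m) *\<^sub>v x"
proof -
  have c: "col_mat x \<in> carrier_mat m 1" using assms(2) by (rule col_mat_carrier)
  have "kron (col_mat p) (col_mat x) = kron (col_mat p) (1\<^sub>m m) * col_mat x"
    using kron_col_mult(1)[OF assms(1) one_carrier_mat c] left_mult_one_mat[OF c] by simp
  moreover have "col (kron (col_mat p) (1\<^sub>m m) * col_mat x) 0 = kron (col_mat p) (1\<^sub>m m) *\<^sub>v col (col_mat x) 0"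
    using c assms by (intro col_mult2[of _ "n * m" m _ 1]) auto
  moreover have "col (col_mat x) 0 = x" by (rule eq_vecI) (auto simp: col_mat_def)
  ultimately show ?thesis unfolding kron_vec_def by simp
qed

lemma dataDp_carrier:
  "dataDp Nd np nx nu ud pd xd \<in> carrier_mat (nx + (np * nx + (nu + np * nu))) (Nd - 1)"
  unfolding dataDp_def dataU_def dataUp_def by (intro vcat_carrier) auto

text \<open>Column by column this is the system equation along the recorded trajectory, once A(p) x
  is written as A_0 x plus the concatenated coefficients applied to p \<otimes> x, and likewise for
  B(p) u.\<close>

lemma dataXplus_eq:
  assumes A: "\<forall>i\<le>np. A i \<in> carrier_mat nx nx" and B: "\<forall>i\<le>np. B i \<in> carrier_mat nx nu"
    and dims: "\<forall>k\<in>{1..Nd}. ud k \<in> carrier_vec nu \<and> pd k \<in> carrier_vec np \<and> xd k \<in> carrier_vec nx"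
    and traj: "\<forall>k\<in>{1..<Nd}. xd (Suc k) =
        affine_mat np nx nx A (pd k) *\<^sub>v xd k + affine_mat np nx nu B (pd k) *\<^sub>v ud k"
  shows "dataXplus Nd nx xd = sys_mat np nx A B * dataDp Nd np nx nu ud pd xd"
proof -
  let ?Ab = "Kbar np nx A" and ?Bb = "Kbar np nx B"
  have c: "A 0 \<in> carrier_mat nx nx" "?Ab \<in> carrier_mat nx (np * nx)"
    "B 0 \<in> carrier_mat nx nu" "?Bb \<in> carrier_mat nx (np * nu)"
    using A B Kbar_carrier[OF A] Kbar_carrier[OF B] by auto
  have "sys_mat np nx A B * dataDp Nd np nx nu ud pd xd
      = A 0 * dataU Nd nx xd + (?Ab * dataUp Nd np nx pd xd + (B 0 * dataU Nd nu ud + ?Bb * dataUp Nd np nu pd ud))"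
    unfolding dataDp_def by (rule sys_mat_mult[OF A B]) (auto simp: dataU_def dataUp_def)
  also have "dataXplus Nd nx xd = \<dots>"
  proof (rule eq_matI)
    fix i j
    assume "i < dim_row (A 0 * dataU Nd nx xd + (?Ab * dataUp Nd np nx pd xd + (B 0 * dataU Nd nu ud + ?Bb * dataUp Nd np nu pd ud)))"
      "j < dim_col (A 0 * dataU Nd nx xd + (?Ab * dataUp Nd np nx pd xd + (B 0 * dataU Nd nu ud + ?Bb * dataUp Nd np nu pd ud)))"
    then have i: "i < nx" and j: "j < Nd - 1" using c by (auto simp: dataUp_def)
    \<comment> \<open>Columns are counted from 0 and samples from 1, so column j holds sample k = j
      + 1 in the regressor and sample k + 1 in the successor matrix.\<close>
    define k where "k = Suc j"
    have k: "k \<in> {1..<Nd}" "k \<in> {1..Nd}" using j by (auto simp: k_def)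
    have p: "pd k \<in> carrier_vec np" and x: "xd k \<in> carrier_vec nx" and u: "ud k \<in> carrier_vec nu"
      using dims k by auto
    have nth: "[1..<Nd] ! j = k" "[2..<Suc Nd] ! j = Suc k" using j by (auto simp: k_def simp del: upt_Suc)
    have kc: "kron (col_mat (pd k)) (1\<^sub>m nx) \<in> carrier_mat (np * nx) nx"
       "kron (col_mat (pd k)) (1\<^sub>m nu) \<in> carrier_mat (np * nu) nu" using p by simp_all
    have kv: "kron_vec (pd k) (xd k) \<in> carrier_vec (np * nx)" "kron_vec (pd k) (ud k) \<in> carrier_vec (np * nu)"
      unfolding kron_vec_eq[OF p x] kron_vec_eq[OF p u] using kc x u by auto
    have "dataXplus Nd nx xd $$ (i, j) = xd (Suc k) $ i"
      using i j nth(2) unfolding dataXplus_def by (simp add: mat_of_cols_index del: upt_Suc)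
    also have "xd (Suc k) = (A 0 *\<^sub>v xd k + ?Ab *\<^sub>v kron_vec (pd k) (xd k)) + (B 0 *\<^sub>v ud k + ?Bb *\<^sub>v kron_vec (pd k) (ud k))"
    proof -
      have "affine_mat np nx nx A (pd k) *\<^sub>v xd k = A 0 *\<^sub>v xd k + ?Ab *\<^sub>v kron_vec (pd k) (xd k)"
        unfolding affine_mat_eq[OF A p] kron_vec_eq[OF p x] using c kc x
        by (subst add_mult_distrib_mat_vec[of _ nx nx]) (auto simp: assoc_mult_mat_vec)
      moreover have "affine_mat np nx nu B (pd k) *\<^sub>v ud k = B 0 *\<^sub>v ud k + ?Bb *\<^sub>v kron_vec (pd k) (ud k)"
        unfolding affine_mat_eq[OF B p] kron_vec_eq[OF p u] using c kc u
        by (subst add_mult_distrib_mat_vec[of _ nx nu]) (auto simp: assoc_mult_mat_vec)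
      ultimately show ?thesis using traj k by simp
    qed
    also have "\<dots> $ i = (A 0 * dataU Nd nx xd + (?Ab * dataUp Nd np nx pd xd + (B 0 * dataU Nd nu ud + ?Bb * dataUp Nd np nu pd ud))) $$ (i, j)"
      using c i j x u kv nth(1) unfolding dataU_def dataUp_def
      by (simp add: add.assoc del: upt_Suc)
    finally show "dataXplus Nd nx xd $$ (i, j) = (A 0 * dataU Nd nx xd + (?Ab * dataUp Nd np nx pd xd + (B 0 * dataU Nd nu ud + ?Bb * dataUp Nd np nu pd ud))) $$ (i, j)" .
  qed (use c in \<open>auto simp: dataXplus_def dataUp_def\<close>)
  finally show ?thesis by simp
qed

text \<open>The system matrix meets the stack (I, p \<otimes> I, K(p), p \<otimes> K(p)). The
  factorisation p \<otimes> K(p) = (p \<otimes> I) K(p) lets the two input blocks recombine to B(p)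
  K(p).\<close>

lemma sys_mat_mult_M_CL_Pi3:
  assumes A: "\<forall>i\<le>np. A i \<in> carrier_mat nx nx" and B: "\<forall>i\<le>np. B i \<in> carrier_mat nx nu"
    and K: "\<forall>i\<le>np. K i \<in> carrier_mat nu nx" and p: "p \<in> carrier_vec np"
  shows "sys_mat np nx A B * (M_CL np nx nu K * Pi3 nx p)
    = affine_mat np nx nx A p + affine_mat np nx nu B p * affine_mat np nu nx K p"
proof -
  let ?K = "affine_mat np nu nx K p"
  have c: "A 0 \<in> carrier_mat nx nx" "Kbar np nx A \<in> carrier_mat nx (np * nx)"
    "B 0 \<in> carrier_mat nx nu" "Kbar np nx B \<in> carrier_mat nx (np * nu)"
    using A B Kbar_carrier[OF A] Kbar_carrier[OF B] by auto
  have K': "?K \<in> carrier_mat nu nx" by simp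
  have pu: "kron (col_mat p) (1\<^sub>m nu) \<in> carrier_mat (np * nu) nu"
    and px: "kron (col_mat p) (1\<^sub>m nx) \<in> carrier_mat (np * nx) nx" using p by simp_all
  have "sys_mat np nx A B * (M_CL np nx nu K * Pi3 nx p) = A 0 * 1\<^sub>m nx + (Kbar np nx A * kron (col_mat p) (1\<^sub>m nx)
      + (B 0 * ?K + Kbar np nx B * kron (col_mat p) ?K))"
    unfolding M_CL_mult_Pi3[OF p K] using p by (intro sys_mat_mult[OF A B]) auto
  also have "kron (col_mat p) ?K = kron (col_mat p) (1\<^sub>m nu) * ?K"
    using kron_col_mult(1)[OF p one_carrier_mat K'] left_mult_one_mat[OF K'] by simp
  also have "B 0 * ?K + Kbar np nx B * (kron (col_mat p) (1\<^sub>m nu) * ?K) = affine_mat np nx nu B p * ?K"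
    unfolding affine_mat_eq[OF B p] using c pu K'
    by (subst add_mult_distrib_mat[of _ nx nu]) (auto simp: assoc_mult_mat[of _ nx "np * nu" _ nu _ nx])
  also have "A 0 * 1\<^sub>m nx + (Kbar np nx A * kron (col_mat p) (1\<^sub>m nx) + affine_mat np nx nu B p * ?K)
      = affine_mat np nx nx A p + affine_mat np nx nu B p * ?K"
    unfolding affine_mat_eq[OF A p] using c px
    by (subst assoc_add_mat[of _ nx nx]) (auto intro: mult_carrier_mat)
  finally show ?thesis .
qed

section \<open>Quadratic forms and dual contractions\<close>

lemma scalar_prod_self_nonneg: "0 \<le> (v :: real vec) \<bullet> v"
  by (auto simp: scalar_prod_def intro: sum_nonneg)

lemma scalar_prod_self_pos:
  assumes "v \<in> carrier_vec n" "v \<noteq> 0\<^sub>v n"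
  shows "0 < (v :: real vec) \<bullet> v"
proof -
  obtain i where "i < n" "v $ i \<noteq> 0" using assms by (auto simp: vec_eq_iff)
  then have "0 < v $ i * v $ i" "v $ i * v $ i \<le> (\<Sum>i=0..<n. v $ i * v $ i)"
    by (auto intro!: member_le_sum simp: zero_less_mult_iff linorder_neq_iff)
  then show ?thesis using assms by (simp add: scalar_prod_def)
qed

lemma scalar_prod_Cauchy_Schwarz:
  assumes "dim_vec v = dim_vec (w :: real vec)"
  shows "(v \<bullet> w)\<^sup>2 \<le> (v \<bullet> v) * (w \<bullet> w)"
  using Cauchy_Schwarz_ineq_sum[of "($) v" "($) w" "{0..<dim_vec w}"] assms
  by (simp add: scalar_prod_def power2_eq_square)

lemma quadratic_form_eq:
  assumes "A \<in> carrier_mat n n" "v \<in> carrier_vec n"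
  shows "v \<bullet> (A *\<^sub>v v) = (\<Sum>i<n. \<Sum>j<n. v $ i * (A $$ (i, j) * v $ j))"
  using assms by (simp add: scalar_prod_def row_def lessThan_atLeast0 sum_distrib_left)

text \<open>The unit sphere of R^n, encoded as functions that vanish from n on. It is a closed
  subset of a product of intervals [-1, 1] and singletons {0}, which is compact by
  Tychonoff.\<close>

lemma compact_unit_sphere_fun:
  "compact {f :: nat \<Rightarrow> real. (\<forall>i\<ge>n. f i = 0) \<and> (\<Sum>i<n. f i * f i) = 1}"
proof -
  let ?B = "\<lambda>i::nat. if i < n then {-1..1::real} else {0}"
  have "compactin (product_topology (\<lambda>_. euclidean) UNIV) (PiE UNIV ?B)"
    unfolding compactin_PiE by auto
  then have "compact (PiE UNIV ?B)" by (simp add: euclidean_product_topology)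
  moreover have "closed {f :: nat \<Rightarrow> real. (\<Sum>i<n. f i * f i) = 1}"
    by (intro closed_Collect_eq continuous_intros) auto
  ultimately have "compact (PiE UNIV ?B \<inter> {f. (\<Sum>i<n. f i * f i) = 1})"
    by (rule compact_Int_closed)
  moreover have "PiE UNIV ?B \<inter> {f. (\<Sum>i<n. f i * f i) = 1}
      = {f. (\<forall>i\<ge>n. f i = 0) \<and> (\<Sum>i<n. f i * f i) = 1}"
  proof -
    have a: "f i \<in> ?B i" if f: "\<forall>i\<ge>n. f i = 0" "(\<Sum>i<n. f i * f i) = 1" for f :: "nat \<Rightarrow> real" and i
    proof (cases "i < n")
      case True
      then have "f i * f i \<le> (\<Sum>i<n. f i * f i)" by (intro member_le_sum) auto
      then have "\<bar>f i\<bar> \<le> 1" using f abs_square_le_1[of "f i"] by (simp add: power2_eq_square)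
      then show ?thesis using True by (simp add: abs_le_iff)
    qed (use f in simp)
    have b: "f i = 0" if "f \<in> PiE UNIV ?B" "n \<le> i" for f i
      using PiE_mem[OF that(1), of i] that(2) by simp
    have "f \<in> PiE UNIV ?B \<longleftrightarrow> (\<forall>i\<ge>n. f i = 0)" if "(\<Sum>i<n. f i * f i) = 1" for f
    proof
      assume "f \<in> PiE UNIV ?B"
      then show "\<forall>i\<ge>n. f i = 0" using b by blast
    next
      assume "\<forall>i\<ge>n. f i = 0"
      then have "\<And>i. f i \<in> ?B i" using that by (rule a)
      then show "f \<in> PiE UNIV ?B" unfolding PiE_UNIV_domain by (rule Pi_I)
    qed
    then show ?thesis by blast
  qed
  ultimately show ?thesis by simp
qed

text \<open>The form attains its minimum on the unit sphere, the minimum is positive because a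
  minimiser is nonzero, and homogeneity of degree two extends the bound to all vectors.\<close>

lemma quadratic_form_lower_bound:
  fixes A :: "real mat"
  assumes A: "A \<in> carrier_mat n n"
    and pos: "\<And>v. v \<in> carrier_vec n \<Longrightarrow> v \<noteq> 0\<^sub>v n \<Longrightarrow> 0 < v \<bullet> (A *\<^sub>v v)"
  obtains c where "c > 0" "\<And>v. v \<in> carrier_vec n \<Longrightarrow> c * (v \<bullet> v) \<le> v \<bullet> (A *\<^sub>v v)"
proof -
  define S :: "(nat \<Rightarrow> real) set" where "S = {f. (\<forall>i\<ge>n. f i = 0) \<and> (\<Sum>i<n. f i * f i) = 1}"
  define q where "q f = (\<Sum>i<n. \<Sum>j<n. f i * (A $$ (i, j) * f j))" for f :: "nat \<Rightarrow> real"
  have q: "v \<bullet> (A *\<^sub>v v) = q (\<lambda>i. if i < n then v $ i else 0)" if "v \<in> carrier_vec n" for v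
    unfolding q_def quadratic_form_eq[OF A that] by (intro sum.cong) auto
  have unit: "\<exists>f\<in>S. v \<bullet> (A *\<^sub>v v) = q f * (v \<bullet> v)" if v: "v \<in> carrier_vec n" "v \<noteq> 0\<^sub>v n" for v
  proof -
    define s where "s = sqrt (v \<bullet> v)"
    have s: "s > 0" "s * s = v \<bullet> v" using scalar_prod_self_pos[OF v] by (auto simp: s_def)
    \<comment> \<open>The normalised vector, extended by zero to a function.\<close>
    define f where "f i = (if i < n then v $ i / s else 0)" for i
    have "(\<Sum>i<n. f i * f i) = (\<Sum>i<n. v $ i * v $ i) / (s * s)"
      unfolding f_def sum_divide_distrib by (intro sum.cong) auto
    also have "(\<Sum>i<n. v $ i * v $ i) = s * s"
      using s(2) v by (simp add: scalar_prod_def lessThan_atLeast0)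
    also have "s * s / (s * s) = 1" using s(1) by simp
    finally have "f \<in> S" by (auto simp: S_def f_def)
    moreover have "q f * (s * s) = v \<bullet> (A *\<^sub>v v)"
      unfolding q_def f_def quadratic_form_eq[OF A v(1)] sum_distrib_right using s(1)
      by (intro sum.cong) auto
    ultimately show ?thesis unfolding s(2) by (intro bexI[of _ f]) simp_all
  qed
  show ?thesis
  proof (cases "S = {}")
    \<comment> \<open>Every nonzero vector yields a point of the sphere, so an empty sphere leaves
      only the zero vector and any positive constant serves.\<close>
    case True
    have "1 * (v \<bullet> v) \<le> v \<bullet> (A *\<^sub>v v)" if v: "v \<in> carrier_vec n" for v
    proof -
      have "v = 0\<^sub>v n" using unit[OF v] True by auto
      then show ?thesis using A by simp
    qed
    then show ?thesis using that[of 1] by simp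
  next
    case False
    have "continuous_on S q" unfolding q_def by (intro continuous_intros continuous_on_subset[OF continuous_on_product_coordinates]) auto
    moreover have "compact S" unfolding S_def by (rule compact_unit_sphere_fun)
    ultimately obtain f where f: "f \<in> S" "\<And>g. g \<in> S \<Longrightarrow> q f \<le> q g"
      using continuous_attains_inf[of S q] False by auto
    have "vec n f \<noteq> 0\<^sub>v n"
    proof
      assume "vec n f = 0\<^sub>v n"
      then have "f i = 0" if "i < n" for i using that by (auto simp: vec_eq_iff)
      then have "(\<Sum>i<n. f i * f i) = 0" by simp
      then show False using f(1) by (simp add: S_def)
    qed
    moreover have "q (\<lambda>i. if i < n then vec n f $ i else 0) = q f"
      unfolding q_def by (intro sum.cong) auto
    ultimately have "0 < q f" using pos[of "vec n f"] q[of "vec n f"] by simp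
    moreover have "q f * (v \<bullet> v) \<le> v \<bullet> (A *\<^sub>v v)" if v: "v \<in> carrier_vec n" for v
    proof (cases "v = 0\<^sub>v n")
      case False
      then obtain g where "g \<in> S" "v \<bullet> (A *\<^sub>v v) = q g * (v \<bullet> v)" using unit[OF v] by auto
      then show ?thesis using f(2) scalar_prod_self_nonneg by (simp add: mult_right_mono)
    qed (use A in simp)
    ultimately show ?thesis using that by blast
  qed
qed

lemma quadratic_form_upper_bound:
  fixes A :: "real mat"
  assumes A: "A \<in> carrier_mat n n"
  obtains C where "C > 0" "\<And>v. v \<in> carrier_vec n \<Longrightarrow> v \<bullet> (A *\<^sub>v v) \<le> C * (v \<bullet> v)"
proof
  \<comment> \<open>The summand 1 makes the constant positive even for a zero matrix; it later
    appears as a divisor.\<close>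
  let ?C = "1 + (\<Sum>i<n. \<Sum>j<n. \<bar>A $$ (i, j)\<bar>)"
  have "0 \<le> (\<Sum>i<n. \<Sum>j<n. \<bar>A $$ (i, j)\<bar>)" by (intro sum_nonneg) simp
  then show "?C > 0" by linarith
  fix v :: "real vec" assume v: "v \<in> carrier_vec n"
  have le: "v $ i * v $ i \<le> v \<bullet> v" if "i < n" for i
    using v that unfolding scalar_prod_def by (auto intro!: member_le_sum[where f = "\<lambda>i. v $ i * v $ i"])
  have "v \<bullet> (A *\<^sub>v v) \<le> (\<Sum>i<n. \<Sum>j<n. \<bar>A $$ (i, j)\<bar> * (v \<bullet> v))"
    unfolding quadratic_form_eq[OF A v]
  proof (intro sum_mono)
    fix i j assume ij: "i \<in> {..<n}" "j \<in> {..<n}"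
    have "2 * \<bar>v $ i * v $ j\<bar> \<le> v $ i * v $ i + v $ j * v $ j"
      using sum_squares_bound[of "\<bar>v $ i\<bar>" "\<bar>v $ j\<bar>"] by (simp add: abs_mult power2_eq_square)
    then have "\<bar>v $ i * v $ j\<bar> \<le> v \<bullet> v" using le[of i] le[of j] ij by simp
    then have "\<bar>A $$ (i, j)\<bar> * \<bar>v $ i * v $ j\<bar> \<le> \<bar>A $$ (i, j)\<bar> * (v \<bullet> v)" by (intro mult_left_mono) auto
    moreover have "v $ i * (A $$ (i, j) * v $ j) \<le> \<bar>A $$ (i, j)\<bar> * \<bar>v $ i * v $ j\<bar>"
      by (simp add: abs_mult[symmetric] mult.left_commute)
    ultimately show "v $ i * (A $$ (i, j) * v $ j) \<le> \<bar>A $$ (i, j)\<bar> * (v \<bullet> v)" by linarith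
  qed
  also have "\<dots> \<le> ?C * (v \<bullet> v)"
    using scalar_prod_self_nonneg[of v] by (simp add: sum_distrib_right distrib_right)
  finally show "v \<bullet> (A *\<^sub>v v) \<le> ?C * (v \<bullet> v)" .
qed

text \<open>Pairing x k with a test vector w moves each factor Y to the other side as its transpose,
  where the contraction is available. At time 0 Cauchy-Schwarz and the lower bound on P compare the
  pairing with w^T P w.\<close>

lemma dual_contraction_decay:
  fixes x :: "nat \<Rightarrow> real vec"
  assumes Y: "\<And>k. Y k \<in> carrier_mat n n" and P: "P \<in> carrier_mat n n"
    and x0: "x 0 \<in> carrier_vec n" and x: "\<And>k. x (Suc k) = Y k *\<^sub>v x k"
    and c: "c > 0" "\<And>w. w \<in> carrier_vec n \<Longrightarrow> c * (w \<bullet> w) \<le> w \<bullet> (P *\<^sub>v w)"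
    and C: "\<And>w. w \<in> carrier_vec n \<Longrightarrow> w \<bullet> (P *\<^sub>v w) \<le> C * (w \<bullet> w)"
    and \<rho>: "0 \<le> \<rho>"
    and dual: "\<And>k w. w \<in> carrier_vec n \<Longrightarrow>
      (transpose_mat (Y k) *\<^sub>v w) \<bullet> (P *\<^sub>v (transpose_mat (Y k) *\<^sub>v w)) \<le> \<rho> * (w \<bullet> (P *\<^sub>v w))"
  shows "c * (x k \<bullet> x k) \<le> C * \<rho> ^ k * (x 0 \<bullet> x 0)"
proof -
  have xc: "x k \<in> carrier_vec n" for k
  proof (induction k)
    case (Suc k)
    then show ?case using Y[of k] x[of k] by simp
  qed (rule x0)
  \<comment> \<open>The claim is for all w at once, since the induction step replaces w by its image
    under the transpose of Y k.\<close>
  have main: "c * (x k \<bullet> w)\<^sup>2 \<le> (x 0 \<bullet> x 0) * (\<rho> ^ k * (w \<bullet> (P *\<^sub>v w)))"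
    if "w \<in> carrier_vec n" for k w
    using that
  proof (induction k arbitrary: w)
    case 0
    have "(x 0 \<bullet> w)\<^sup>2 \<le> (x 0 \<bullet> x 0) * (w \<bullet> w)"
      using 0 x0 by (intro scalar_prod_Cauchy_Schwarz) simp
    then have "c * (x 0 \<bullet> w)\<^sup>2 \<le> (x 0 \<bullet> x 0) * (c * (w \<bullet> w))"
      using c(1) by (simp add: mult_left_mono mult.left_commute)
    also have "\<dots> \<le> (x 0 \<bullet> x 0) * (w \<bullet> (P *\<^sub>v w))"
      using c(2)[OF 0] scalar_prod_self_nonneg by (rule mult_left_mono)
    finally show ?case by simp
  next
    case (Suc k)
    let ?w = "transpose_mat (Y k) *\<^sub>v w"
    have w: "?w \<in> carrier_vec n" using Suc.prems Y[of k] by simp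
    have "x (Suc k) \<bullet> w = w \<bullet> (Y k *\<^sub>v x k)"
      using Suc.prems xc[of "Suc k"] comm_scalar_prod unfolding x by blast
    also have "\<dots> = ?w \<bullet> x k"
      by (rule transpose_vec_mult_scalar[symmetric, OF Y xc Suc.prems])
    also have "\<dots> = x k \<bullet> ?w" using w xc by (rule comm_scalar_prod)
    finally have "c * (x (Suc k) \<bullet> w)\<^sup>2 \<le> (x 0 \<bullet> x 0) * (\<rho> ^ k * (?w \<bullet> (P *\<^sub>v ?w)))"
      using Suc.IH[OF w] by simp
    also have "\<dots> \<le> (x 0 \<bullet> x 0) * (\<rho> ^ k * (\<rho> * (w \<bullet> (P *\<^sub>v w))))"
      using dual[OF Suc.prems] \<rho> by (intro mult_left_mono scalar_prod_self_nonneg) auto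
    finally show ?case by (simp add: mult.assoc mult.left_commute)
  qed
  show ?thesis
  proof (cases "x k \<bullet> x k = 0")
    \<comment> \<open>Only nonnegativity of the right-hand side is at stake; comparing the two
      bounds on P at x 0 shows that C (x 0 \<bullet> x 0) is nonnegative.\<close>
    case True
    have "0 \<le> C * (x 0 \<bullet> x 0)"
      using c(1) c(2)[OF x0] C[OF x0] scalar_prod_self_nonneg[of "x 0"]
      by (smt (verit) mult_nonneg_nonneg)
    then have "0 \<le> \<rho> ^ k * (C * (x 0 \<bullet> x 0))" using \<rho> by simp
    then show ?thesis using True by (simp add: mult.assoc mult.left_commute)
  next
    case False
    then have pos: "x k \<bullet> x k > 0" using scalar_prod_self_nonneg[of "x k"] by simp
    \<comment> \<open>Test vector w = x k: both sides then carry a factor x k \<bullet> x k, which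
      cancels.\<close>
    have "c * (x k \<bullet> x k)\<^sup>2 \<le> (x 0 \<bullet> x 0) * (\<rho> ^ k * (x k \<bullet> (P *\<^sub>v x k)))"
      by (rule main[OF xc])
    also have "\<dots> \<le> (x 0 \<bullet> x 0) * (\<rho> ^ k * (C * (x k \<bullet> x k)))"
      using C[OF xc] \<rho> by (intro mult_left_mono scalar_prod_self_nonneg) auto
    finally have "(c * (x k \<bullet> x k)) * (x k \<bullet> x k) \<le> (C * \<rho> ^ k * (x 0 \<bullet> x 0)) * (x k \<bullet> x k)"
      by (simp add: power2_eq_square algebra_simps)
    then show ?thesis using pos by simp
  qed
qed

section \<open>The full-block matrix inequality\<close>

lemma quadratic_form_congruence:
  fixes A :: "real mat"
  assumes "A \<in> carrier_mat m m" "M \<in> carrier_mat m n" "x \<in> carrier_vec n" "y \<in> carrier_vec n"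
  shows "x \<bullet> ((transpose_mat M * A * M) *\<^sub>v y) = (M *\<^sub>v x) \<bullet> (A *\<^sub>v (M *\<^sub>v y))"
proof -
  have c: "A *\<^sub>v (M *\<^sub>v y) \<in> carrier_vec m" "M *\<^sub>v x \<in> carrier_vec m"
    "transpose_mat M *\<^sub>v (A *\<^sub>v (M *\<^sub>v y)) \<in> carrier_vec n" using assms by auto
  have "(transpose_mat M * A * M) *\<^sub>v y = transpose_mat M *\<^sub>v (A *\<^sub>v (M *\<^sub>v y))"
    using assms
    by (simp add: assoc_mult_mat[of _ n m _ m _ n] assoc_mult_mat_vec[of _ n m _ n] assoc_mult_mat_vec[of _ m m _ n])
  then have "x \<bullet> ((transpose_mat M * A * M) *\<^sub>v y) = (transpose_mat M *\<^sub>v (A *\<^sub>v (M *\<^sub>v y))) \<bullet> x"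
    using comm_scalar_prod[OF assms(3) c(3)] by simp
  also have "\<dots> = (A *\<^sub>v (M *\<^sub>v y)) \<bullet> (M *\<^sub>v x)"
    using transpose_vec_mult_scalar[OF assms(2,3) c(1)] .
  also have "\<dots> = (M *\<^sub>v x) \<bullet> (A *\<^sub>v (M *\<^sub>v y))"
    using c(1,2) by (rule comm_scalar_prod)
  finally show ?thesis .
qed

section \<open>Closing the scheduling loop in the linear fractional representation\<close>

lemma E_carrier: "E1 nx \<in> carrier_mat nx (2 * nx)" "E2 nx \<in> carrier_mat nx (2 * nx)"
  unfolding E1_def E2_def mult_2 by (auto intro: hcat_carrier)

lemma E_mult_append:
  assumes "x \<in> carrier_vec nx" "y \<in> carrier_vec nx"
  shows "E1 nx *\<^sub>v (x @\<^sub>v y) = x" "E2 nx *\<^sub>v (x @\<^sub>v y) = y"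
proof -
  have z: "0\<^sub>m nx nx *\<^sub>v v = 0\<^sub>v nx" if "v \<in> carrier_vec nx" for v :: "real vec"
    using that by (intro eq_vecI) auto
  show "E1 nx *\<^sub>v (x @\<^sub>v y) = x" "E2 nx *\<^sub>v (x @\<^sub>v y) = y"
    unfolding E1_def E2_def using assms
    by (simp_all add: hcat_mult_append[of _ nx nx _ nx] z)
qed

text \<open>By the mixed product, (diag(p) \<otimes> I)(1 \<otimes> I) = (diag(p) 1) \<otimes> I,
  and diag(p) applied to the all-ones vector is p.\<close>

lemma Delta_mult_L12:
  assumes "p \<in> carrier_vec np"
  shows "Delta nx p * L12 np nx = kron (col_mat p) (1\<^sub>m (2 * nx))"
  unfolding Delta_def L12_def
    kron_mult[OF diag_vec_carrier[OF assms] one_carrier_mat ones_mat_carrier one_carrier_mat]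
    diag_vec_mult_ones[OF assms] by simp

text \<open>The output of the representation with the scheduling block closed: a stacked pair (x, y)
  is sent to the vectors (x, p \<otimes> x) and (y, p \<otimes> y) on which W acts.\<close>

lemma L_mult_eq:
  assumes p: "p \<in> carrier_vec np"
  shows "L21 np nx * kron (col_mat p) (1\<^sub>m (2 * nx)) + L22 np nx
    = vcat (Pi2 nx p * E1 nx) (Pi2 nx p * E2 nx)"
proof -
  let ?m = "np * (2 * nx)" and ?d = "2 * nx"
  let ?pI = "kron (col_mat p) (1\<^sub>m ?d)"
  have pI: "?pI \<in> carrier_mat ?m ?d" using p by simp
  have m: "2 * nx * np = ?m" by simp
  have k: "kron (1\<^sub>m np) (E1 nx) \<in> carrier_mat (np * nx) ?m" "kron (1\<^sub>m np) (E2 nx) \<in> carrier_mat (np * nx) ?m"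
    using E_carrier[of nx] by auto
  have pE: "kron (col_mat p) (E1 nx) \<in> carrier_mat (np * nx) ?d" "kron (col_mat p) (E2 nx) \<in> carrier_mat (np * nx) ?d"
    using E_carrier[of nx] p by auto
  have z: "0\<^sub>m nx ?m \<in> carrier_mat nx ?m" and zd: "0\<^sub>m nx ?d \<in> carrier_mat nx ?d"
    and zn: "0\<^sub>m (np * nx) ?d \<in> carrier_mat (np * nx) ?d" by simp_all
  have zero: "0\<^sub>m nx ?m * ?pI = 0\<^sub>m nx ?d" using pI by simp
  have kE: "kron (1\<^sub>m np) (E1 nx) * ?pI = kron (col_mat p) (E1 nx)"
    "kron (1\<^sub>m np) (E2 nx) * ?pI = kron (col_mat p) (E2 nx)"
    using kron_col_mult(2)[OF p E_carrier(1) one_carrier_mat] kron_col_mult(2)[OF p E_carrier(2) one_carrier_mat]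
      E_carrier[of nx] by simp_all
  have "L21 np nx * ?pI = vcat (0\<^sub>m nx ?d) (vcat (kron (col_mat p) (E1 nx)) (vcat (0\<^sub>m nx ?d) (kron (col_mat p) (E2 nx))))"
    unfolding L21_def m
    by (simp only: vcat_mult[OF z vcat_carrier[OF k(1) vcat_carrier[OF z k(2)]] pI]
      vcat_mult[OF k(1) vcat_carrier[OF z k(2)] pI] vcat_mult[OF z k(2) pI] kE zero)
  moreover have "L22 np nx = vcat (E1 nx) (vcat (0\<^sub>m (np * nx) ?d) (vcat (E2 nx) (0\<^sub>m (np * nx) ?d)))"
    unfolding L22_def kron_zero_right by (simp add: ones_mat_def)
  moreover have "vcat (0\<^sub>m nx ?d) (vcat (kron (col_mat p) (E1 nx)) (vcat (0\<^sub>m nx ?d) (kron (col_mat p) (E2 nx))))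
      + vcat (E1 nx) (vcat (0\<^sub>m (np * nx) ?d) (vcat (E2 nx) (0\<^sub>m (np * nx) ?d)))
      = vcat (E1 nx) (vcat (kron (col_mat p) (E1 nx)) (vcat (E2 nx) (kron (col_mat p) (E2 nx))))"
    using E_carrier[of nx] pE
    by (simp only: vcat_add[OF zd vcat_carrier[OF pE(1) vcat_carrier[OF zd pE(2)]] E_carrier(1) vcat_carrier[OF zn vcat_carrier[OF E_carrier(2) zn]]]
      vcat_add[OF pE(1) vcat_carrier[OF zd pE(2)] zn vcat_carrier[OF E_carrier(2) zn]]
      vcat_add[OF zd pE(2) E_carrier(2) zn] left_add_zero_mat right_add_zero_mat)
  moreover have "\<dots> = vcat (Pi2 nx p * E1 nx) (Pi2 nx p * E2 nx)"
    unfolding Pi2_mult[OF p E_carrier(1)] Pi2_mult[OF p E_carrier(2)]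
    by (rule vcat_assoc[symmetric, OF E_carrier(1) pE(1) vcat_carrier[OF E_carrier(2) pE(2)]])
  ultimately show ?thesis by simp
qed

text \<open>\<open>Pi2\<close> sends x to (x, p \<otimes> x), and the zero block discards the second
  component.\<close>

lemma blkdiag_zero_form:
  assumes p: "p \<in> carrier_vec np" and P: "P \<in> carrier_mat nx nx" and x: "x \<in> carrier_vec nx"
  shows "(Pi2 nx p *\<^sub>v x) \<bullet> (blkdiag P (0\<^sub>m (nx * np) (nx * np)) *\<^sub>v (Pi2 nx p *\<^sub>v x)) = x \<bullet> (P *\<^sub>v x)"
proof -
  let ?px = "kron (col_mat p) (1\<^sub>m nx) *\<^sub>v x"
  have pI: "kron (col_mat p) (1\<^sub>m nx) \<in> carrier_mat (np * nx) nx" using p by simp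
  have px: "?px \<in> carrier_vec (np * nx)" using pI x by simp
  have e: "Pi2 nx p *\<^sub>v x = x @\<^sub>v ?px"
    unfolding Pi2_def vcat_mult_vec[OF one_carrier_mat pI x] using x by simp
  have "blkdiag P (0\<^sub>m (nx * np) (nx * np)) *\<^sub>v (x @\<^sub>v ?px) = (P *\<^sub>v x) @\<^sub>v (0\<^sub>m (np * nx) (np * nx) *\<^sub>v ?px)"
    using P x px unfolding blkdiag_def
    by (simp add: mult.commute[of nx np] mult_mat_vec_split[OF P zero_carrier_mat x px])
  moreover have "0\<^sub>m (np * nx) (np * nx) *\<^sub>v ?px = 0\<^sub>v (np * nx)"
    using px by (intro eq_vecI) auto
  ultimately show ?thesis
    unfolding e using P x px
    by (simp add: scalar_prod_append[of _ nx _ "np * nx"])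
qed

lemma full_block_LMI_form_bound:
  assumes PP: "PP \<subseteq> carrier_vec np" and P: "P \<in> carrier_mat nx nx"
    and S: "S \<in> carrier_mat (nx + np * nx) (nx + np * nx)"
    and Xi: "Xi \<in> carrier_mat (4 * np * nx) (4 * np * nx)"
    and W: "W = four_block_mat (blkdiag P (0\<^sub>m (nx * np) (nx * np))) S (transpose_mat S) (blkdiag P (0\<^sub>m (nx * np) (nx * np)))"
    and LMI: "full_block_LMI PP (Delta nx) W (L11 np nx) (L12 np nx) (L21 np nx) (L22 np nx) Xi"
  obtains e where "e > 0"
    "\<And>p x y. p \<in> PP \<Longrightarrow> x \<in> carrier_vec nx \<Longrightarrow> y \<in> carrier_vec nx \<Longrightarrow>
      e * (x \<bullet> x) \<le> x \<bullet> (P *\<^sub>v x) + 2 * (x \<bullet> ((transpose_mat (Pi2 nx p) * S * Pi2 nx p) *\<^sub>v y)) + y \<bullet> (P *\<^sub>v y)"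
proof -
  \<comment> \<open>Dimensions of the scheduling channel, of a stacked pair (x, y), and of the
    lifted vector (x, p \<otimes> x).\<close>
  define m d l where "m = np * (2 * nx)" and "d = 2 * nx" and "l = nx + np * nx"
  let ?P0 = "blkdiag P (0\<^sub>m (nx * np) (nx * np))"
  have P0: "?P0 \<in> carrier_mat l l" using P unfolding l_def by (simp add: mult.commute)
  have S: "S \<in> carrier_mat l l" using S unfolding l_def .
  have Wc: "W \<in> carrier_mat (l + l) (l + l)" unfolding W using P0 S by simp
  have Xic: "Xi \<in> carrier_mat (m + m) (m + m)" using Xi by (simp add: m_def mult.assoc)
  have L11: "L11 np nx = 0\<^sub>m m m" unfolding L11_def m_def by (simp add: mult.commute)
  have L12c: "L12 np nx \<in> carrier_mat m d"
    using kron_carrier[OF ones_mat_carrier one_carrier_mat, of np d] unfolding L12_def m_def d_def by simp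
  have L21c: "L21 np nx \<in> carrier_mat (l + l) m"
  proof -
    have "l + l = nx + (np * nx + (nx + np * nx))" "2 * nx * np = m" by (simp_all add: l_def m_def)
    moreover have "kron (1\<^sub>m np) (E1 nx) \<in> carrier_mat (np * nx) m" "kron (1\<^sub>m np) (E2 nx) \<in> carrier_mat (np * nx) m"
      unfolding m_def by (intro kron_carrier one_carrier_mat E_carrier)+
    ultimately show ?thesis
      unfolding L21_def by (simp only: vcat_carrier zero_carrier_mat)
  qed
  have L22c: "L22 np nx \<in> carrier_mat (l + l) d"
    unfolding L22_def l_def d_def kron_zero_right using E_carrier[of nx]
    by (auto simp: add.assoc ones_mat_def intro!: vcat_carrier)
  define Lup where "Lup = four_block_mat (L11 np nx) (L12 np nx) (1\<^sub>m (dim_row (L11 np nx))) (0\<^sub>m (dim_row (L11 np nx)) (dim_col (L12 np nx)))"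
  define Llo where "Llo = hcat (L21 np nx) (L22 np nx)"
  have Lup: "Lup = four_block_mat (0\<^sub>m m m) (L12 np nx) (1\<^sub>m m) (0\<^sub>m m d)"
    unfolding Lup_def L11 using L12c by simp
  have Lupc: "Lup \<in> carrier_mat (m + m) (m + d)" unfolding Lup using L12c by simp
  have Lloc: "Llo \<in> carrier_mat (l + l) (m + d)" unfolding Llo_def using L21c L22c by simp
  define N where "N = transpose_mat Lup * Xi * Lup - transpose_mat Llo * W * Llo"
  have N1: "transpose_mat Lup * Xi * Lup \<in> carrier_mat (m + d) (m + d)"
    and N2: "transpose_mat Llo * W * Llo \<in> carrier_mat (m + d) (m + d)"
    using Lupc Xic Lloc Wc by auto
  have Nc: "N \<in> carrier_mat (m + d) (m + d)" unfolding N_def using N1 N2 by (intro minus_carrier_mat)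
  have neg: "neg_def N" and semi: "\<And>p. p \<in> PP \<Longrightarrow> pos_semidef (transpose_mat (vcat (1\<^sub>m (dim_row (Delta nx p))) (Delta nx p)) * Xi
      * vcat (1\<^sub>m (dim_row (Delta nx p))) (Delta nx p))"
    using LMI unfolding full_block_LMI_def N_def Lup_def Llo_def Let_def by auto
  have N: "v \<bullet> ((- N) *\<^sub>v v) = (Llo *\<^sub>v v) \<bullet> (W *\<^sub>v (Llo *\<^sub>v v)) - (Lup *\<^sub>v v) \<bullet> (Xi *\<^sub>v (Lup *\<^sub>v v))"
    if v: "v \<in> carrier_vec (m + d)" for v
  proof -
    have "v \<bullet> ((- N) *\<^sub>v v) = - (v \<bullet> (N *\<^sub>v v))" using v Nc by simp
    also have "N *\<^sub>v v = (transpose_mat Lup * Xi * Lup) *\<^sub>v v - (transpose_mat Llo * W * Llo) *\<^sub>v v"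
      unfolding N_def by (rule minus_mult_distrib_mat_vec[OF N1 N2 v])
    also have "v \<bullet> \<dots> = v \<bullet> ((transpose_mat Lup * Xi * Lup) *\<^sub>v v) - v \<bullet> ((transpose_mat Llo * W * Llo) *\<^sub>v v)"
      using N1 N2 v by (intro scalar_prod_minus_distrib[of _ "m + d"]) auto
    finally show ?thesis
      using quadratic_form_congruence[OF Xic Lupc v v] quadratic_form_congruence[OF Wc Lloc v v] by simp
  qed
  have "0 < v \<bullet> ((- N) *\<^sub>v v)" if v: "v \<in> carrier_vec (m + d)" "v \<noteq> 0\<^sub>v (m + d)" for v
  proof -
    have "v \<bullet> (N *\<^sub>v v) < 0" using neg v Nc unfolding neg_def_def by auto
    then show ?thesis using v Nc by simp
  qed
  \<comment> \<open>The margin is fixed before p is chosen, since N is a constant matrix.\<close>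
  then obtain e where e: "e > 0" "\<And>v. v \<in> carrier_vec (m + d) \<Longrightarrow> e * (v \<bullet> v) \<le> v \<bullet> ((- N) *\<^sub>v v)"
    using quadratic_form_lower_bound[of "- N" "m + d"] Nc by auto
  have "e * (x \<bullet> x) \<le> x \<bullet> (P *\<^sub>v x) + 2 * (x \<bullet> ((transpose_mat (Pi2 nx p) * S * Pi2 nx p) *\<^sub>v y)) + y \<bullet> (P *\<^sub>v y)"
    if pPP: "p \<in> PP" and x: "x \<in> carrier_vec nx" and y: "y \<in> carrier_vec nx" for p x y
  proof -
    have p: "p \<in> carrier_vec np" using PP pPP by auto
    let ?pI = "kron (col_mat p) (1\<^sub>m (2 * nx))"
    have pI: "?pI \<in> carrier_mat m d" using p unfolding m_def d_def by simp
    have Pi: "Pi2 nx p \<in> carrier_mat l nx" using p unfolding l_def by simp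
    define w where "w = x @\<^sub>v y"
    have w: "w \<in> carrier_vec d" using x y unfolding w_def d_def mult_2 by simp
    define q where "q = ?pI *\<^sub>v w"
    have q: "q \<in> carrier_vec m" using pI w unfolding q_def by simp
    have v: "q @\<^sub>v w \<in> carrier_vec (m + d)" using q w by simp
    \<comment> \<open>z is the input and q the output of the scheduling block: q = \<Delta>(p) z.
      The upper factor therefore sends (q, w) to (z, \<Delta>(p) z), in the range of
      [I; \<Delta>(p)], where the form of \<Xi> is nonnegative.\<close>
    define z where "z = L12 np nx *\<^sub>v w"
    have z: "z \<in> carrier_vec m" using L12c w unfolding z_def by simp
    have Dc: "Delta nx p \<in> carrier_mat m m" unfolding Delta_def m_def using p by simp
    have Dz: "Delta nx p *\<^sub>v z = q"
      unfolding z_def q_def Delta_mult_L12[OF p, symmetric]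
      by (rule assoc_mult_mat_vec[symmetric, OF Dc L12c w])
    have z0: "0\<^sub>m m m *\<^sub>v q = 0\<^sub>v m" "0\<^sub>m m d *\<^sub>v w = 0\<^sub>v m" using q w by (auto intro!: eq_vecI)
    have "Lup *\<^sub>v (q @\<^sub>v w) = (0\<^sub>m m m *\<^sub>v q + L12 np nx *\<^sub>v w) @\<^sub>v (1\<^sub>m m *\<^sub>v q + 0\<^sub>m m d *\<^sub>v w)"
      unfolding Lup using L12c q w by (intro four_block_mat_mult_vec) auto
    also have "\<dots> = z @\<^sub>v q" unfolding z0 z_def[symmetric] using z q by simp
    also have "\<dots> = vcat (1\<^sub>m (dim_row (Delta nx p))) (Delta nx p) *\<^sub>v z"
      using Dc z Dz by (simp add: vcat_mult_vec[OF one_carrier_mat Dc z])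
    finally have up: "Lup *\<^sub>v (q @\<^sub>v w) = vcat (1\<^sub>m (dim_row (Delta nx p))) (Delta nx p) *\<^sub>v z" .
    have Vc: "vcat (1\<^sub>m (dim_row (Delta nx p))) (Delta nx p) \<in> carrier_mat (m + m) m" using Dc by auto
    have "0 \<le> (Lup *\<^sub>v (q @\<^sub>v w)) \<bullet> (Xi *\<^sub>v (Lup *\<^sub>v (q @\<^sub>v w)))"
      using semi[OF pPP] z Vc unfolding up quadratic_form_congruence[OF Xic Vc z z, symmetric] pos_semidef_def
      by auto
    moreover
    let ?a = "Pi2 nx p *\<^sub>v x" and ?b = "Pi2 nx p *\<^sub>v y"
    have a: "?a \<in> carrier_vec l" and b: "?b \<in> carrier_vec l" using Pi x y by auto
    have "Llo *\<^sub>v (q @\<^sub>v w) = ?a @\<^sub>v ?b"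
    proof -
      have E: "E1 nx \<in> carrier_mat nx d" "E2 nx \<in> carrier_mat nx d" using E_carrier unfolding d_def by auto
      have "Llo *\<^sub>v (q @\<^sub>v w) = L21 np nx *\<^sub>v q + L22 np nx *\<^sub>v w"
        unfolding Llo_def by (rule hcat_mult_append[OF L21c L22c q w])
      also have "L21 np nx *\<^sub>v q = (L21 np nx * ?pI) *\<^sub>v w"
        unfolding q_def by (rule assoc_mult_mat_vec[symmetric, OF L21c pI w])
      also have "\<dots> + L22 np nx *\<^sub>v w = (L21 np nx * ?pI + L22 np nx) *\<^sub>v w"
        using L21c pI L22c w by (intro add_mult_distrib_mat_vec[symmetric]) auto
      also have "\<dots> = (Pi2 nx p * E1 nx) *\<^sub>v w @\<^sub>v (Pi2 nx p * E2 nx) *\<^sub>v w"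
        unfolding L_mult_eq[OF p] using Pi E w by (intro vcat_mult_vec) auto
      also have "\<dots> = ?a @\<^sub>v ?b"
        unfolding assoc_mult_mat_vec[OF Pi E(1) w] assoc_mult_mat_vec[OF Pi E(2) w]
        unfolding w_def E_mult_append[OF x y] ..
      finally show ?thesis .
    qed
    moreover have "(?a @\<^sub>v ?b) \<bullet> (W *\<^sub>v (?a @\<^sub>v ?b))
      = x \<bullet> (P *\<^sub>v x) + 2 * (x \<bullet> ((transpose_mat (Pi2 nx p) * S * Pi2 nx p) *\<^sub>v y)) + y \<bullet> (P *\<^sub>v y)"
    proof -
      have St: "transpose_mat S \<in> carrier_mat l l" using S by simp
      have c: "?P0 *\<^sub>v ?a \<in> carrier_vec l" "S *\<^sub>v ?b \<in> carrier_vec l"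
        "transpose_mat S *\<^sub>v ?a \<in> carrier_vec l" "?P0 *\<^sub>v ?b \<in> carrier_vec l"
        using P0 S St a b by auto
      have "W *\<^sub>v (?a @\<^sub>v ?b) = (?P0 *\<^sub>v ?a + S *\<^sub>v ?b) @\<^sub>v (transpose_mat S *\<^sub>v ?a + ?P0 *\<^sub>v ?b)"
        unfolding W by (rule four_block_mat_mult_vec[OF P0 S St P0 a b])
      then have "(?a @\<^sub>v ?b) \<bullet> (W *\<^sub>v (?a @\<^sub>v ?b))
          = ?a \<bullet> (?P0 *\<^sub>v ?a + S *\<^sub>v ?b) + ?b \<bullet> (transpose_mat S *\<^sub>v ?a + ?P0 *\<^sub>v ?b)"
        using a b c by (simp add: scalar_prod_append[of _ l _ l])
      also have "\<dots> = (?a \<bullet> (?P0 *\<^sub>v ?a) + ?a \<bullet> (S *\<^sub>v ?b)) + (?b \<bullet> (transpose_mat S *\<^sub>v ?a) + ?b \<bullet> (?P0 *\<^sub>v ?b))"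
        unfolding scalar_prod_add_distrib[OF a c(1,2)] scalar_prod_add_distrib[OF b c(3,4)] ..
      \<comment> \<open>The two off-diagonal terms coincide, which produces the factor 2.\<close>
      also have "?b \<bullet> (transpose_mat S *\<^sub>v ?a) = (transpose_mat S *\<^sub>v ?a) \<bullet> ?b"
        by (rule comm_scalar_prod[OF b c(3)])
      also have "\<dots> = ?a \<bullet> (S *\<^sub>v ?b)" by (rule transpose_vec_mult_scalar[OF S b a])
      finally show ?thesis
        unfolding blkdiag_zero_form[OF p P x] blkdiag_zero_form[OF p P y]
          quadratic_form_congruence[OF S Pi x y] by simp
    qed
    \<comment> \<open>Of the squared norm |q|^2 + |x|^2 + |y|^2 only |x|^2 is kept.\<close>
    moreover have "x \<bullet> x \<le> (q @\<^sub>v w) \<bullet> (q @\<^sub>v w)"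
      using scalar_prod_append[OF q w q w] scalar_prod_append[OF x y x y] w_def
        scalar_prod_self_nonneg[of q] scalar_prod_self_nonneg[of y] by simp
    then have "e * (x \<bullet> x) \<le> e * ((q @\<^sub>v w) \<bullet> (q @\<^sub>v w))" using e(1) by simp
    ultimately show ?thesis using e(2)[OF v] N[OF v] by simp
  qed
  then show ?thesis using that e(1) by blast
qed

text \<open>After transposition this is (I \<otimes> X^T)(p \<otimes> I) = (p \<otimes> I) X^T. It
  exchanges the basis of state dimension n for the one of data length N, in which the relation
  between F and \<open>FQ\<close> is formulated.\<close>

lemma transpose_Pi2_mult_blkdiag:
  assumes p: "p \<in> carrier_vec np" and X: "X \<in> carrier_mat n N"
  shows "transpose_mat (Pi2 n p) * blkdiag X (kron (1\<^sub>m np) X) = X * transpose_mat (Pi2 N p)"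
proof -
  let ?Xt = "transpose_mat X"
  have Xt: "?Xt \<in> carrier_mat N n" using X by simp
  have kX: "kron (1\<^sub>m np) X \<in> carrier_mat (np * n) (np * N)"
    and kXt: "kron (1\<^sub>m np) ?Xt \<in> carrier_mat (np * N) (np * n)" using X by auto
  have pI: "kron (col_mat p) (1\<^sub>m n) \<in> carrier_mat (np * n) n" using p by simp
  have XX: "blkdiag X (kron (1\<^sub>m np) X) \<in> carrier_mat (n + np * n) (N + np * N)" using X kX by simp
  have "transpose_mat (blkdiag X (kron (1\<^sub>m np) X)) = blkdiag ?Xt (kron (1\<^sub>m np) ?Xt)"
    unfolding blkdiag_def using X kX
    by (subst transpose_four_block_mat[of _ n N _ "np * N" _ "np * n"]) (simp_all add: transpose_kron carrier_matD[OF kX] carrier_matD[OF kXt])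
  then have "transpose_mat (transpose_mat (Pi2 n p) * blkdiag X (kron (1\<^sub>m np) X))
      = blkdiag ?Xt (kron (1\<^sub>m np) ?Xt) * Pi2 n p"
    using transpose_mult[OF _ XX, of "transpose_mat (Pi2 n p)" n] p by simp
  also have "\<dots> = vcat (?Xt * 1\<^sub>m n) (kron (1\<^sub>m np) ?Xt * kron (col_mat p) (1\<^sub>m n))"
    unfolding Pi2_def by (rule blkdiag_mult_vcat[OF Xt kXt one_carrier_mat pI])
  also have "\<dots> = vcat ?Xt (kron (col_mat p) ?Xt)"
    using kron_col_mult(2)[OF p Xt one_carrier_mat] Xt by simp
  also have "\<dots> = Pi2 N p * ?Xt" by (rule Pi2_mult[OF p Xt, symmetric])
  also have "\<dots> = transpose_mat (X * transpose_mat (Pi2 N p))"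
    using transpose_mult[OF X, of "transpose_mat (Pi2 N p)" "N + np * N"] p by simp
  finally show ?thesis by (metis transpose_transpose)
qed

text \<open>Taking square roots gives |x_k| \<le> sqrt(D \<rho>^k) |x_0| with D = C / c. Stability
  uses \<rho>^k \<le> 1, attraction uses \<rho>^k \<longrightarrow> 0.\<close>

lemma stabilizesI:
  assumes PP: "PP \<subseteq> carrier_vec np" and c: "c > 0" and C: "C \<ge> 0" and \<rho>: "0 \<le> \<rho>" "\<rho> < 1"
    and decay: "\<And>p x0 k. (\<And>k. p k \<in> PP) \<Longrightarrow> x0 \<in> carrier_vec nx \<Longrightarrow>
      c * (cl_traj np nx nu A B K p x0 k \<bullet> cl_traj np nx nu A B K p x0 k) \<le> C * \<rho> ^ k * (x0 \<bullet> x0)"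
  shows "stabilizes np nx nu PP A B K"
  unfolding stabilizes_def
proof (intro allI impI conjI ballI)
  fix p :: "nat \<Rightarrow> real vec" assume p: "\<forall>k. p k \<in> PP"
  define D where "D = C / c"
  have D: "D \<ge> 0" using c C by (simp add: D_def)
  have bound: "vnorm (cl_traj np nx nu A B K p x0 k) \<le> sqrt (D * \<rho> ^ k) * vnorm x0"
    if "x0 \<in> carrier_vec nx" for x0 k
  proof -
    have "cl_traj np nx nu A B K p x0 k \<bullet> cl_traj np nx nu A B K p x0 k \<le> D * \<rho> ^ k * (x0 \<bullet> x0)"
      using decay[of p x0 k] p that c by (simp add: D_def field_simps)
    then show ?thesis unfolding vnorm_def real_sqrt_mult[symmetric] by simp
  qed
  {
    fix \<epsilon> :: real assume \<epsilon>: "\<epsilon> > 0"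
    \<comment> \<open>The radius is \<epsilon> / (sqrt D + 1); the added 1 keeps the denominator
      positive when D = 0.\<close>
    have "vnorm (cl_traj np nx nu A B K p x0 k) < \<epsilon>"
      if x0: "x0 \<in> carrier_vec nx" "vnorm x0 < \<epsilon> / (sqrt D + 1)" for x0 k
    proof -
      have "0 \<le> vnorm x0" unfolding vnorm_def using scalar_prod_self_nonneg by simp
      moreover have "sqrt (D * \<rho> ^ k) \<le> sqrt D"
        using D \<rho> by (simp add: mult_left_le power_le_one)
      then have "sqrt (D * \<rho> ^ k) \<le> sqrt D + 1" by linarith
      ultimately have "sqrt (D * \<rho> ^ k) * vnorm x0 \<le> (sqrt D + 1) * vnorm x0"
        by (intro mult_right_mono) auto
      also have "\<dots> < \<epsilon>"
        using x0(2) D by (subst mult.commute, subst pos_less_divide_eq[symmetric]) (simp_all add: add_nonneg_pos)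
      finally show ?thesis using bound[OF x0(1), of k] by simp
    qed
    moreover have "\<epsilon> / (sqrt D + 1) > 0" using \<epsilon> D by (simp add: add_nonneg_pos)
    ultimately show "\<exists>\<delta>>0. \<forall>x0\<in>carrier_vec nx. vnorm x0 < \<delta> \<longrightarrow>
        (\<forall>k. vnorm (cl_traj np nx nu A B K p x0 k) < \<epsilon>)" by blast
  }
  fix x0 :: "real vec" assume x0: "x0 \<in> carrier_vec nx"
  have "(\<lambda>k. sqrt (D * \<rho> ^ k) * vnorm x0) \<longlonglongrightarrow> sqrt (D * 0) * vnorm x0"
    using \<rho> by (intro tendsto_intros LIMSEQ_realpow_zero)
  then have lim: "(\<lambda>k. sqrt (D * \<rho> ^ k) * vnorm x0) \<longlonglongrightarrow> 0" by simp
  show "(\<lambda>k. vnorm (cl_traj np nx nu A B K p x0 k)) \<longlonglongrightarrow> 0"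
  proof (rule tendsto_sandwich[OF _ _ tendsto_const lim])
    show "\<forall>\<^sub>F k in sequentially. 0 \<le> vnorm (cl_traj np nx nu A B K p x0 k)"
      by (simp add: vnorm_def scalar_prod_self_nonneg)
    show "\<forall>\<^sub>F k in sequentially. vnorm (cl_traj np nx nu A B K p x0 k) \<le> sqrt (D * \<rho> ^ k) * vnorm x0"
      by (intro always_eventually allI bound[OF x0])
  qed
qed

section \<open>From the data-based conditions to stability of the closed loop\<close>

theorem theorem2:
  fixes np nx nu Nd :: nat
    and PP :: "real vec set"
    and A B K :: "nat \<Rightarrow> real mat"
    and ud pd xd :: "nat \<Rightarrow> real vec"
    and P F FQ Xi :: "real mat"
  assumes sched: "sched_set np PP"
    and dimA: "\<forall>i\<le>np. A i \<in> carrier_mat nx nx"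
    and dimB: "\<forall>i\<le>np. B i \<in> carrier_mat nx nu"
    and dimK: "\<forall>i\<le>np. K i \<in> carrier_mat nu nx"
    and data_dims: "\<forall>k\<in>{1..Nd}. ud k \<in> carrier_vec nu \<and> pd k \<in> PP \<and> xd k \<in> carrier_vec nx"
    and data_traj: "\<forall>k\<in>{1..<Nd}. xd (Suc k) =
        affine_mat np nx nx A (pd k) *\<^sub>v xd k + affine_mat np nx nu B (pd k) *\<^sub>v ud k"
    and full_rank: "vec_space.rank ((1 + np) * (nx + nu)) (dataDp Nd np nx nu ud pd xd)
                      = (1 + np) * (nx + nu)"
    and P_sym: "sym_mat nx P" and P_pos: "pos_def P"
    and F_dim: "F \<in> carrier_mat (Nd - 1) (nx * (1 + np + np * np))"
    and FQ_dim: "FQ \<in> carrier_mat ((Nd - 1) * (1 + np)) (nx * (1 + np))"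
    and F_FQ: "\<forall>p\<in>PP. F * Pi3 nx p = transpose_mat (Pi2 (Nd - 1) p) * FQ * Pi2 nx p"
    and Xi_sym: "sym_mat (4 * np * nx) Xi"
    and eq: "M_CL np nx nu K * P_blk np P = dataDp Nd np nx nu ud pd xd * F"
    and LMI: "full_block_LMI PP (Delta nx) (W_mat np nx P (dataXplus Nd nx xd) FQ)
                (L11 np nx) (L12 np nx) (L21 np nx) (L22 np nx) Xi"
  shows "stabilizes np nx nu PP A B K"
proof -
  define N where "N = Nd - 1"
  define X where "X = dataXplus Nd nx xd"
  define XX where "XX = blkdiag X (kron (1\<^sub>m np) X)"
  define D where "D = dataDp Nd np nx nu ud pd xd"
  define G where "G = sys_mat np nx A B"
  define Y where "Y p = affine_mat np nx nx A p + affine_mat np nx nu B p * affine_mat np nu nx K p" for p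
  let ?l = "nx + np * nx" and ?h = "nx + (np * nx + (nu + np * nu))" and ?t = "nx + (np * nx + np * (np * nx))"
  have PP: "PP \<subseteq> carrier_vec np" using sched by (simp add: sched_set_def)
  have Pc: "P \<in> carrier_mat nx nx" using P_sym by (simp add: sym_mat_def)
  have Xc: "X \<in> carrier_mat nx N" unfolding X_def dataXplus_def N_def by auto
  have XXc: "XX \<in> carrier_mat ?l (N + np * N)" unfolding XX_def using Xc by simp
  have FQc: "FQ \<in> carrier_mat (N + np * N) ?l" using FQ_dim by (simp add: N_def distrib_left mult.commute)
  have Fc: "F \<in> carrier_mat N ?t" using F_dim by (simp add: N_def algebra_simps)
  have Dc: "D \<in> carrier_mat ?h N" unfolding D_def N_def by (rule dataDp_carrier)
  have Gc: "G \<in> carrier_mat nx ?h" unfolding G_def by (rule sys_mat_carrier[OF dimA dimB])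
  have Yc: "Y p \<in> carrier_mat nx nx" for p
    unfolding Y_def by (auto intro: add_carrier_mat mult_carrier_mat)
  have Mc: "M_CL np nx nu K \<in> carrier_mat ?h ?t" by (rule M_CL_carrier[OF dimK])
  have Pbc: "P_blk np P \<in> carrier_mat ?t ?t" unfolding P_blk_def using Pc by simp
  have XGD: "X = G * D"
    unfolding X_def G_def D_def using data_dims PP by (intro dataXplus_eq[OF dimA dimB _ data_traj]) auto
  \<comment> \<open>The chain is: pull X to the left, use the relation between \<open>FQ\<close> and
    F, insert X = G D, replace D F by \<open>M_CL\<close> times the block copies of P, and commute P
    to the right past the scheduling basis.\<close>
  have closed_loop: "transpose_mat (Pi2 nx p) * (XX * FQ) * Pi2 nx p = Y p * P" if "p \<in> PP" for p
  proof -
    have p: "p \<in> carrier_vec np" using that PP by auto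
    have Pi: "Pi2 nx p \<in> carrier_mat ?l nx" "Pi2 N p \<in> carrier_mat (N + np * N) N"
      "Pi3 nx p \<in> carrier_mat ?t nx" using p by auto
    have Pit: "transpose_mat (Pi2 nx p) \<in> carrier_mat nx ?l" "transpose_mat (Pi2 N p) \<in> carrier_mat N (N + np * N)"
      using Pi by auto
    have "transpose_mat (Pi2 nx p) * (XX * FQ) * Pi2 nx p = transpose_mat (Pi2 nx p) * XX * FQ * Pi2 nx p"
      using assoc_mult_mat[OF Pit(1) XXc FQc] by simp
    also have "transpose_mat (Pi2 nx p) * XX = X * transpose_mat (Pi2 N p)"
      unfolding XX_def by (rule transpose_Pi2_mult_blkdiag[OF p Xc])
    also have "X * transpose_mat (Pi2 N p) * FQ * Pi2 nx p = X * (transpose_mat (Pi2 N p) * FQ * Pi2 nx p)"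
      using assoc_mult_mat[OF Xc Pit(2) FQc] assoc_mult_mat[OF Xc mult_carrier_mat[OF Pit(2) FQc] Pi(1)] by simp
    also have "\<dots> = G * D * (F * Pi3 nx p)" using F_FQ that XGD by (simp add: N_def)
    also have "\<dots> = G * (D * F * Pi3 nx p)"
      using assoc_mult_mat[OF Gc Dc mult_carrier_mat[OF Fc Pi(3)]] assoc_mult_mat[OF Dc Fc Pi(3)] by simp
    also have "D * F * Pi3 nx p = M_CL np nx nu K * Pi3 nx p * P"
      using eq assoc_mult_mat[OF Mc Pbc Pi(3)] P_blk_mult_Pi3[OF p Pc] assoc_mult_mat[OF Mc Pi(3) Pc]
      by (simp add: D_def)
    also have "G * (M_CL np nx nu K * Pi3 nx p * P) = G * (M_CL np nx nu K * Pi3 nx p) * P"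
      by (rule assoc_mult_mat[symmetric, OF Gc mult_carrier_mat[OF Mc Pi(3)] Pc])
    also have "G * (M_CL np nx nu K * Pi3 nx p) = Y p"
      unfolding G_def Y_def by (rule sys_mat_mult_M_CL_Pi3[OF dimA dimB dimK p])
    finally show ?thesis .
  qed
  have Xic: "Xi \<in> carrier_mat (4 * np * nx) (4 * np * nx)" using Xi_sym by (simp add: sym_mat_def)
  have W: "W_mat np nx P (dataXplus Nd nx xd) FQ = four_block_mat (blkdiag P (0\<^sub>m (nx * np) (nx * np))) (XX * FQ)
      (transpose_mat (XX * FQ)) (blkdiag P (0\<^sub>m (nx * np) (nx * np)))"
    by (simp add: W_mat_def XX_def X_def Let_def)
  obtain e where e: "e > 0" and form: "\<And>p x y. p \<in> PP \<Longrightarrow> x \<in> carrier_vec nx \<Longrightarrow> y \<in> carrier_vec nx \<Longrightarrow>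
      e * (x \<bullet> x) \<le> x \<bullet> (P *\<^sub>v x) + 2 * (x \<bullet> ((transpose_mat (Pi2 nx p) * (XX * FQ) * Pi2 nx p) *\<^sub>v y)) + y \<bullet> (P *\<^sub>v y)"
    using full_block_LMI_form_bound[OF PP Pc mult_carrier_mat[OF XXc FQc] Xic W LMI] by blast
  obtain c where c: "c > 0" "\<And>v. v \<in> carrier_vec nx \<Longrightarrow> c * (v \<bullet> v) \<le> v \<bullet> (P *\<^sub>v v)"
    using quadratic_form_lower_bound[OF Pc] P_pos Pc unfolding pos_def_def by auto
  obtain C where C: "C > 0" "\<And>v. v \<in> carrier_vec nx \<Longrightarrow> v \<bullet> (P *\<^sub>v v) \<le> C * (v \<bullet> v)"
    using quadratic_form_upper_bound[OF Pc] by blast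
  \<comment> \<open>Since |w|^2 is at least w^T P w / C, a loss of e |w|^2 is a relative loss of e /
    C in the form of P; the maximum with 0 supplies nonnegativity directly.\<close>
  define \<rho> where "\<rho> = max 0 (1 - e / C)"
  have \<rho>: "0 \<le> \<rho>" "\<rho> < 1" using e C(1) by (auto simp: \<rho>_def)
  have dual: "(transpose_mat (Y p) *\<^sub>v w) \<bullet> (P *\<^sub>v (transpose_mat (Y p) *\<^sub>v w)) \<le> \<rho> * (w \<bullet> (P *\<^sub>v w))"
    if pPP: "p \<in> PP" and w: "w \<in> carrier_vec nx" for p w
  proof -
    define u where "u = transpose_mat (Y p) *\<^sub>v w"
    have u: "u \<in> carrier_vec nx" using Yc[of p] w unfolding u_def by simp
    have Pu: "P *\<^sub>v u \<in> carrier_vec nx" using Pc u by simp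
    have m: "P *\<^sub>v (- u) = - (P *\<^sub>v u)" if "u \<in> carrier_vec nx" "P \<in> carrier_mat nx nx" for P :: "real mat" and u
      using that by (intro eq_vecI) auto
    have "w \<bullet> ((Y p * P) *\<^sub>v (- u)) = - (w \<bullet> (Y p *\<^sub>v (P *\<^sub>v u)))"
      using u Pu w Yc[of p] Pc by (simp add: m assoc_mult_mat_vec[of _ nx nx _ nx])
    also have "w \<bullet> (Y p *\<^sub>v (P *\<^sub>v u)) = u \<bullet> (P *\<^sub>v u)"
      unfolding u_def[symmetric] using transpose_vec_mult_scalar[OF Yc[of p] Pu w] u_def by simp
    \<comment> \<open>With y = -u the cross term contributes -2 u^T P u and the last term u^T P u,
      which leaves -u^T P u.\<close>
    finally have "e * (w \<bullet> w) \<le> w \<bullet> (P *\<^sub>v w) - u \<bullet> (P *\<^sub>v u)"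
      using form[OF pPP w, of "- u"] u Pu Pc unfolding closed_loop[OF pPP] by (simp add: m)
    moreover have "e / C * (w \<bullet> (P *\<^sub>v w)) \<le> e / C * (C * (w \<bullet> w))"
      using C(2)[OF w] e C(1) by (intro mult_left_mono) auto
    then have "e / C * (w \<bullet> (P *\<^sub>v w)) \<le> e * (w \<bullet> w)" using C(1) by simp
    ultimately have "u \<bullet> (P *\<^sub>v u) \<le> (1 - e / C) * (w \<bullet> (P *\<^sub>v w))" by (simp add: left_diff_distrib)
    also have "\<dots> \<le> \<rho> * (w \<bullet> (P *\<^sub>v w))"
    proof (rule mult_right_mono)
      show "0 \<le> w \<bullet> (P *\<^sub>v w)"
        using c(2)[OF w] c(1) scalar_prod_self_nonneg[of w] by (meson mult_nonneg_nonneg order_trans less_imp_le)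
    qed (simp add: \<rho>_def)
    finally show ?thesis unfolding u_def .
  qed
  show ?thesis
  proof (rule stabilizesI[OF PP c(1) less_imp_le[OF C(1)] \<rho>])
    fix p :: "nat \<Rightarrow> real vec" and x0 :: "real vec" and k assume p: "\<And>k. p k \<in> PP" and x0: "x0 \<in> carrier_vec nx"
    show "c * (cl_traj np nx nu A B K p x0 k \<bullet> cl_traj np nx nu A B K p x0 k) \<le> C * \<rho> ^ k * (x0 \<bullet> x0)"
      \<comment> \<open>The factor \<rho> is the same for every value of p, so an arbitrarily
        time-varying scheduling trajectory is covered step by step.\<close>
      using dual_contraction_decay[of "\<lambda>k. Y (p k)" nx P "cl_traj np nx nu A B K p x0" c C \<rho> k,
          OF Yc Pc _ _ c C(2) \<rho>(1) dual[OF p]] x0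
      by (simp add: Y_def)
  qed
qed

end
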